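(* Let $D$ be a pseudo-adequate virtual link diagram representing a virtual link $L$, let $c(D)$ be the number of real crossings of $D$, and let $\chi(D)$ be the Euler characteristic of the Turaev surface $T_D$. Then $$\mathrm{span}(L) = 4c(D) + 2(\chi(D)-2).$$
   Context: **Virtual link diagrams.** Virtual link diagrams are in the sense of Kauffman (generic immersed closed curves in the plane with real crossings and virtual crossings); two are equivalent if related by a finite sequence of Reidemeister moves and virtual Reidemeister moves, and a virtual link is an equivalence class. $c(D)$ is the number of real crossings of $D$. **Splices.** At a real crossing whose over-strand runs from bottom-left to top-right and whose under-strand runs from top-left to bottom-right, the A-splice replaces the crossing by two vertical strands $)\,($ (one joining the two left endpoints, the other the two right endpoints), and the B-splice replaces it by two horizontal strands (one joining the two top endpoints, the other the two bottom endpoints). **States and bracket.** A state $s$ of $D$ is a map from the set of real crossings of $D$ to $\{\mathrm{A},\mathrm{B}\}$; $\mathcal{S}$ is the set of states. $D(s)$ is the diagram obtained from $D$ by performing the $s(p)$-splice at each real crossing $p$ (virtual crossings are kept), and $\sharp D(s)$ is its number of components (closed curves). Put $\alpha(s)=\sharp s^{-1}(\mathrm{A})$, $\beta(s)=\sharp s^{-1}(\mathrm{B})$, $\langle D/s\rangle = A^{\alpha(s)-\beta(s)}(-A^2-A^{-2})^{\sharp D(s)-1}\in\mathbb{Z}[A,A^{-1}]$ and $\langle D\rangle=\sum_{s\in\mathcal{S}}\langle D/s\rangle$ (Kauffman bracket). For a Laurent polynomial $f$, $\mathrm{span}(f)$ is the maximal degree of $f$ minus the minimal degree of $f$. $\mathrm{span}\langle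 D\rangle$ is invariant under Reidemeister and virtual Reidemeister moves, and $\mathrm{span}(L):=\mathrm{span}\langle D\rangle$ for any diagram $D$ representing $L$. **Pseudo-adequacy.** $s_A$ (resp. $s_B$) is the state sending every real crossing to A (resp. B). $D$ is pseudo-adequate if $\sharp D(s_A)\ge \sharp D(s_A(1))$ for every state $s_A(1)$ that sends exactly one real crossing to B and all others to A, and $\sharp D(s_B)\ge\sharp D(s_B(1))$ for every state $s_B(1)$ that sends exactly one real crossing to A and all others to B. **Turaev surface $T_D$.** Replace each real crossing of $D$ by a disk and join the disks by bands, one for each arc of $D$ (an edge of $D$ viewed as a 4-valent graph whose vertices are the real crossings; virtual crossings are ignored, the bands simply passing each other), so that the resulting surface $F'(D)$ is orientable and is embedded in the plane along $D$ except near virtual crossings. Near each real crossing the boundary of $F'(D)$ consists of four corner arcs, one in each quadrant; colour red the two opposite corners corresponding to the two strands of the A-splice and blue the two opposite corners corresponding to the two strands of the B-splice. Insert a half twist in each band for which this is needed to make the colours extend consistently along the whole boundary. The resulting surface with boundary is $F(D)$; its red boundary components correspond to the components of $D(s_A)$ and its blue ones to those of $D(s_B)$. $T_D$ is the closed (possibly non-orientable, possibly disconnected) surface obtained by attaching a disk along each component of $\partial F(D)$. A component of $D$ having no real crossing contributes a 2-sphere to $T_D$. *)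

theory Defs
  imports "HOL-Library.Poly_Mapping" "HOL-Library.Multiset" "HOL-Library.FuncSet"
begin

text \<open>
  A virtual link diagram is encoded by a planar diagram code.  The immersed curves are cut into
  edges at their crossings and at finitely many further points (\<open>Joint\<close>s); the edges are labelled
  by natural numbers.  A node lists the labels at its ends in counterclockwise order.  In
  \<open>Crossing k a b c d\<close> the two strands are \<open>a\<close>--\<open>c\<close> and \<open>b\<close>--\<open>d\<close>, and \<open>k\<close> says whether \<open>a\<close>--\<open>c\<close>
  is the over-strand or the under-strand, or whether the crossing is virtual.  Joints are needed to
  represent circles without crossings; adding or removing one is part of the equivalence relation.

  The code does not record the relative position of the connected components of the underlying
  plane graph nor its unbounded face.  The bracket, the Turaev surface and the moves do not depend
  on these data: any edges of two connected components bound a common face in a suitable position,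
  and every move below is realized by one in the plane for such a position.
\<close>

datatype crossing_type = Over | Under | Virtual

datatype (edges: 'e) node =
    Crossing crossing_type 'e 'e 'e 'e
  | Joint 'e 'e
  for map: map_node

type_synonym diagram = "nat node list"

fun ends :: "'e node \<Rightarrow> 'e list" where
  "ends (Crossing k a b c d) = [a, b, c, d]"
| "ends (Joint a b) = [a, b]"

fun strands :: "'e node \<Rightarrow> ('e \<times> 'e) set" where
  "strands (Crossing k a b c d) = {(a, c), (b, d)}"
| "strands (Joint a b) = {(a, b)}"

fun is_real :: "'e node \<Rightarrow> bool" where
  "is_real (Crossing k a b c d) \<longleftrightarrow> k \<noteq> Virtual"
| "is_real (Joint a b) \<longleftrightarrow> False"

definition labels :: "diagram \<Rightarrow> nat set" where
  "labels D = (\<Union>n\<in>set D. edges n)"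

text \<open>The connected components of the graph with vertex set \<open>V\<close> and edge set \<open>E\<close>.\<close>

definition conn_classes :: "'a set \<Rightarrow> ('a \<times> 'a) set \<Rightarrow> 'a set set" where
  "conn_classes V E = V // {(x, y) \<in> V \<times> V. (x, y) \<in> (E \<union> E\<inverse>)\<^sup>*}"


section \<open>Planarity\<close>

text \<open>The pair \<open>(i, k)\<close> stands for the \<open>k\<close>-th end of the \<open>i\<close>-th node.\<close>

definition darts :: "diagram \<Rightarrow> (nat \<times> nat) set" where
  "darts D = {(i, k). i < length D \<and> k < length (ends (D ! i))}"

definition label_of :: "diagram \<Rightarrow> nat \<times> nat \<Rightarrow> nat" where
  "label_of D h = ends (D ! fst h) ! snd h"

definition ccw :: "diagram \<Rightarrow> nat \<times> nat \<Rightarrow> nat \<times> nat" where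
  "ccw D h = (fst h, Suc (snd h) mod length (ends (D ! fst h)))"

definition opposite_darts :: "diagram \<Rightarrow> ((nat \<times> nat) \<times> (nat \<times> nat)) set" where
  "opposite_darts D =
     {(h, h'). h \<in> darts D \<and> h' \<in> darts D \<and> h \<noteq> h' \<and> label_of D h = label_of D h'}"

text \<open>
  A face boundary runs along an edge from its dart \<open>h\<close> to the opposite dart \<open>h'\<close> and leaves the
  node reached there through the next dart in counterclockwise order.
\<close>

definition faces :: "diagram \<Rightarrow> (nat \<times> nat) set set" where
  "faces D = conn_classes (darts D) {(h, ccw D h') | h h'. (h, h') \<in> opposite_darts D}"

definition graph_components :: "diagram \<Rightarrow> (nat \<times> nat) set set" where
  "graph_components D =
     conn_classes (darts D) ({(h, ccw D h) | h. h \<in> darts D} \<union> opposite_darts D)"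

text \<open>Each connected component lies on a sphere: \<open>V - E + F = 2 C\<close>.\<close>

definition planar :: "diagram \<Rightarrow> bool" where
  "planar D \<longleftrightarrow>
     length D + card (faces D) = card (labels D) + 2 * card (graph_components D)"

definition virtual_link_diagram :: "diagram \<Rightarrow> bool" where
  "virtual_link_diagram D \<longleftrightarrow>
     D \<noteq> [] \<and> (\<forall>e\<in>labels D. count_list (concat (map ends D)) e = 2) \<and> planar D"


section \<open>Reidemeister moves and virtual links\<close>

fun reverse_type :: "crossing_type \<Rightarrow> crossing_type" where
  "reverse_type Over = Under"
| "reverse_type Under = Over"
| "reverse_type Virtual = Virtual"

text \<open>
  The first five rules only change the encoding (order of the nodes, names of the edges, the end
  of a node listed first, joints).  The others replace a tangle in a disk.

  \<^item> \<open>R1\<close> comprises both real kinks and the virtual one.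
  \<^item> In \<open>R2\<close>, an upper strand from \<open>a\<close> to \<open>b\<close> is pushed across a lower strand from \<open>c\<close> to \<open>d\<close>
    (both drawn from left to right), over it or virtually.  The case where it is pushed under it
    arises by turning the picture upside down.
  \<^item> In \<open>R3\<close>, the boundary points are \<open>p1, ..., p6\<close> in counterclockwise order, the three strands
    are \<open>p1\<close>--\<open>p4\<close>, \<open>p2\<close>--\<open>p5\<close>, \<open>p3\<close>--\<open>p6\<close> with middle edges \<open>e1, e2, e3\<close>, and the first one is
    moved across the crossing of the other two, over both (then that crossing is real) or
    virtually.  The two choices of a real \<open>k'\<close> for \<open>k = Over\<close> give all height orders of
    the strands, up to rotation of the picture and exchange of the two sides.  For
    \<open>k = Virtual\<close> this is the virtual move with three virtual crossings (\<open>k' = Virtual\<close>) or the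
    mixed one (\<open>k'\<close> real).  The excluded case \<open>k = Over\<close>, \<open>k' = Virtual\<close> is a forbidden move.

  Moves are only applied between diagrams in the sense of \<open>virtual_link_diagram\<close>.  There each
  label occurs exactly twice, so the inner edges of a tangle are automatically new and distinct,
  and planarity of both sides says that the two strands of \<open>R2\<close> face each other as drawn.
\<close>

inductive move :: "diagram \<Rightarrow> diagram \<Rightarrow> bool" where
  reorder: "mset D = mset E \<Longrightarrow> move D E"
| rename: "inj_on f (labels D) \<Longrightarrow> move D (map (map_node f) D)"
| turn_crossing:
    "move (Crossing k a b c d # D) (Crossing (reverse_type k) b c d a # D)"
| turn_joint: "move (Joint a b # D) (Joint b a # D)"
| remove_joint: "a \<noteq> b \<Longrightarrow> move (Joint a b # D) (map (map_node (id(b := a))) D)"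
| R1: "move (Joint a b # D) (Crossing k a b c c # D)"
| R2: "k \<noteq> Under \<Longrightarrow>
    move (Joint a b # Joint c d # D) (Crossing k a c e f # Crossing k e d b f # D)"
| R3: "k \<noteq> Under \<Longrightarrow> \<not> (k = Over \<and> k' = Virtual) \<Longrightarrow>
    move
      (Crossing k p1 p2 e1 e2 # Crossing k e1 p3 p4 e3 # Crossing k' e2 e3 p5 p6 # D)
      (Crossing k e1 e2 p4 p5 # Crossing k p1 e3 e1 p6 # Crossing k' p2 p3 e2 e3 # D)"

definition equivalent_diagrams :: "diagram \<Rightarrow> diagram \<Rightarrow> bool" where
  "equivalent_diagrams =
     equivclp (\<lambda>D E. virtual_link_diagram D \<and> virtual_link_diagram E \<and> move D E)"

definition virtual_links :: "diagram set set" where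
  "virtual_links = Collect virtual_link_diagram //
     {(D, E). virtual_link_diagram D \<and> virtual_link_diagram E \<and> equivalent_diagrams D E}"


section \<open>States and the Kauffman bracket\<close>

text \<open>Real crossings are identified with their positions in the list.\<close>

definition real_crossings :: "diagram \<Rightarrow> nat set" where
  "real_crossings D = {i. i < length D \<and> is_real (D ! i)}"

definition crossing_number :: "diagram \<Rightarrow> nat" where
  "crossing_number D = card (real_crossings D)"

datatype splice_type = ASplice | BSplice

text \<open>
  The A-splice joins each end of the over-strand to the preceding end in counterclockwise order:
  with ends top-left, bottom-left, bottom-right, top-right and over-strand from bottom-left to
  top-right, it joins the two left ends and the two right ends.
\<close>

fun splice_node :: "splice_type \<Rightarrow> 'e node \<Rightarrow> 'e node list" where
  "splice_node ASplice (Crossing Under a b c d) = [Joint a b, Joint c d]"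
| "splice_node BSplice (Crossing Under a b c d) = [Joint b c, Joint d a]"
| "splice_node ASplice (Crossing Over a b c d) = [Joint b c, Joint d a]"
| "splice_node BSplice (Crossing Over a b c d) = [Joint a b, Joint c d]"
| "splice_node t (Crossing Virtual a b c d) = [Crossing Virtual a b c d]"
| "splice_node t (Joint a b) = [Joint a b]"

definition states :: "diagram \<Rightarrow> (nat \<Rightarrow> splice_type) set" where
  "states D = real_crossings D \<rightarrow>\<^sub>E UNIV"

definition spliced :: "diagram \<Rightarrow> (nat \<Rightarrow> splice_type) \<Rightarrow> diagram" where
  "spliced D s = concat (map (\<lambda>i. splice_node (s i) (D ! i)) [0..<length D])"

text \<open>The closed curves of a diagram, each given by its set of edges.\<close>

definition components :: "diagram \<Rightarrow> nat set set" where
  "components D = conn_classes (labels D) (\<Union>n\<in>set D. strands n)"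

definition splice_count :: "diagram \<Rightarrow> (nat \<Rightarrow> splice_type) \<Rightarrow> splice_type \<Rightarrow> nat" where
  "splice_count D s t = card {p \<in> real_crossings D. s p = t}"

text \<open>Laurent polynomials are the elements of the monoid ring over the additive group \<open>int\<close>.\<close>

type_synonym laurent_poly = "int \<Rightarrow>\<^sub>0 int"

definition A_power :: "int \<Rightarrow> laurent_poly" where
  "A_power n = Poly_Mapping.single n 1"

definition state_bracket :: "diagram \<Rightarrow> (nat \<Rightarrow> splice_type) \<Rightarrow> laurent_poly" where
  "state_bracket D s =
     A_power (int (splice_count D s ASplice) - int (splice_count D s BSplice)) *
     (- A_power 2 - A_power (- 2)) ^ (card (components (spliced D s)) - 1)"

definition bracket :: "diagram \<Rightarrow> laurent_poly" where
  "bracket D = (\<Sum>s\<in>states D. state_bracket D s)"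

text \<open>The value at the zero polynomial is irrelevant.\<close>

definition span :: "laurent_poly \<Rightarrow> int" where
  "span f = Max (Poly_Mapping.keys f) - Min (Poly_Mapping.keys f)"

text \<open>The common value of \<open>span (bracket D)\<close> for the diagrams \<open>D\<close> representing \<open>L\<close>.\<close>

definition link_span :: "diagram set \<Rightarrow> int" where
  "link_span L = (THE n. \<forall>D\<in>L. span (bracket D) = n)"


section \<open>Pseudo-adequacy\<close>

definition const_state :: "diagram \<Rightarrow> splice_type \<Rightarrow> nat \<Rightarrow> splice_type" where
  "const_state D t = restrict (\<lambda>p. t) (real_crossings D)"

definition pseudo_adequate :: "diagram \<Rightarrow> bool" where
  "pseudo_adequate D \<longleftrightarrow>
     (\<forall>s\<in>states D. splice_count D s BSplice = 1 \<longrightarrow>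
        card (components (spliced D (const_state D ASplice))) \<ge> card (components (spliced D s))) \<and>
     (\<forall>s\<in>states D. splice_count D s ASplice = 1 \<longrightarrow>
        card (components (spliced D (const_state D BSplice))) \<ge> card (components (spliced D s)))"


section \<open>The Turaev surface\<close>

text \<open>
  A surface made of oriented disks and bands.  The cycles of \<open>next_half\<close> are the disks, each
  with the counterclockwise order of the half-bands attached to it; a band is the pair of its two
  half-bands, and the bands in \<open>twisted\<close> carry a half twist.
\<close>

record 'h band_surface =
  half_bands :: "'h set"
  next_half :: "'h \<Rightarrow> 'h"
  bands :: "'h set set"
  twisted :: "'h set set"

text \<open>
  A half-band has two sides, the left and the right one when looking away from its disk.  The
  boundary of the surface consists of the corner arcs of the disks, which lead from the left side
  of a half-band to the right side of the next one, and of the sides of the bands.  An untwisted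
  band joins opposite sides of its half-bands, a twisted one joins equal sides.
\<close>

datatype side = LeftSide | RightSide

definition boundary_segments :: "'h band_surface \<Rightarrow> (('h \<times> side) \<times> ('h \<times> side)) set" where
  "boundary_segments S =
     {((h, LeftSide), (next_half S h, RightSide)) | h. h \<in> half_bands S} \<union>
     {((h, x), (h', y)) | h h' x y.
        {h, h'} \<in> bands S \<and> h \<noteq> h' \<and> (x = y \<longleftrightarrow> {h, h'} \<in> twisted S)}"

definition boundary_components :: "'h band_surface \<Rightarrow> ('h \<times> side) set set" where
  "boundary_components S = conn_classes (half_bands S \<times> UNIV) (boundary_segments S)"

definition disks :: "'h band_surface \<Rightarrow> 'h set set" where
  "disks S = conn_classes (half_bands S) {(h, next_half S h) | h. h \<in> half_bands S}"

text \<open>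
  Euler characteristic of the closed surface obtained by attaching a disk along each boundary
  component, computed from its handle decomposition.
\<close>

definition closed_euler_char :: "'h band_surface \<Rightarrow> int" where
  "closed_euler_char S =
     int (card (disks S)) - int (card (bands S)) + int (card (boundary_components S))"

definition real_darts :: "diagram \<Rightarrow> (nat \<times> nat) set" where
  "real_darts D = {h \<in> darts D. fst h \<in> real_crossings D}"

text \<open>
  The edges of \<open>D\<close> as a 4-valent graph on the real crossings, each given by its set of labels.
  A closed curve without real crossings also gives one class, which contains no dart of a real
  crossing and hence yields no band.
\<close>

definition arcs :: "diagram \<Rightarrow> nat set set" where
  "arcs D = conn_classes (labels D) (\<Union>n\<in>{n \<in> set D. \<not> is_real n}. strands n)"

definition band_pairs :: "diagram \<Rightarrow> ((nat \<times> nat) \<times> (nat \<times> nat)) set" where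
  "band_pairs D = {(h, h'). h \<in> real_darts D \<and> h' \<in> real_darts D \<and> h \<noteq> h' \<and>
     (\<exists>\<alpha>\<in>arcs D. label_of D h \<in> \<alpha> \<and> label_of D h' \<in> \<alpha>)}"

datatype colour = Red | Blue

text \<open>
  The colour of the corner between the dart \<open>(i, k)\<close> and the next one in counterclockwise order:
  red if the A-splice joins these two ends of the crossing, blue if the B-splice does.
\<close>

fun corner_colour :: "diagram \<Rightarrow> nat \<times> nat \<Rightarrow> colour" where
  "corner_colour D (i, k) =
     (case D ! i of
        Crossing Under a b c d \<Rightarrow> if even k then Red else Blue
      | _ \<Rightarrow> if even k then Blue else Red)"

fun side_colour :: "diagram \<Rightarrow> (nat \<times> nat) \<times> side \<Rightarrow> colour" where
  "side_colour D (h, LeftSide) = corner_colour D h"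
| "side_colour D ((i, k), RightSide) = corner_colour D (i, (k + 3) mod 4)"

text \<open>
  Following an arc through virtual crossings, the left side seen from one end is the right side
  seen from the other end, so the bands of the surface embedded along \<open>D\<close> are untwisted.  A half
  twist is inserted when an untwisted band would join sides of different colours.
\<close>

definition turaev_band_surface :: "diagram \<Rightarrow> (nat \<times> nat) band_surface" where
  "turaev_band_surface D =
     \<lparr>half_bands = real_darts D,
      next_half = ccw D,
      bands = {{h, h'} | h h'. (h, h') \<in> band_pairs D},
      twisted = {{h, h'} | h h'. (h, h') \<in> band_pairs D \<and>
        side_colour D (h, LeftSide) \<noteq> side_colour D (h', RightSide)}\<rparr>"

definition free_components :: "diagram \<Rightarrow> nat set set" where
  "free_components D = {\<gamma> \<in> components D. \<gamma> \<inter> label_of D ` real_darts D = {}}"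

text \<open>A component of \<open>D\<close> without real crossings contributes a sphere.\<close>

definition turaev_euler_char :: "diagram \<Rightarrow> int" where
  "turaev_euler_char D =
     closed_euler_char (turaev_band_surface D) + 2 * int (card (free_components D))"

end

theory Submission
  imports Defs
begin

text \<open>
  In the state sum, the states \<open>s\<^sub>A\<close> and \<open>s\<^sub>B\<close> alone contribute to the extreme degrees: switching one
  splice changes \<open>\<alpha>(s) - \<beta>(s)\<close> by two and the number of curves by at most one, so the top degree
  never rises along a sequence of switches away from \<open>s\<^sub>A\<close>, and by pseudo-adequacy it drops at
  the first switch.  Hence the span is \<open>2 c(D) + 2 (\<sharp>D(s\<^sub>A) + \<sharp>D(s\<^sub>B)) - 4\<close>.  On the other hand
  \<open>F(D)\<close> has \<open>c(D)\<close> disks and \<open>2 c(D)\<close> bands, and its boundary components are the curves of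
  \<open>D(s\<^sub>A)\<close> and \<open>D(s\<^sub>B)\<close> that pass through a real crossing, so that
  \<open>\<chi>(D) = \<sharp>D(s\<^sub>A) + \<sharp>D(s\<^sub>B) - c(D)\<close>.
\<close>

section \<open>Connected components of graphs\<close>

text \<open>\<open>link_span\<close> is meaningful only once all diagrams of a link have brackets of
  equal span, so invariance under the moves is part of the work. The state sum is awkward for it:
  states are functions on list positions, and moves shift positions and replace several crossings at
  once. The recursion \<open>br\<close> resolves nodes one by one and carries the strands found so
  far; a move then becomes an identity between finitely many resolved tangles, valid in every
  surrounding graph.

  With virtual crossings a switch may leave the number of curves unchanged, unlike for classical
  diagrams. The bound of one is therefore proved for components of arbitrary graphs, without
  planarity.

  For the surface there are two levels: curves live on labels, bands and corners on darts. An arc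
  may run through many labels, and that it ends in exactly two real darts is itself obtained by
  counting.\<close>

definition conn :: "('a \<times> 'a) set \<Rightarrow> ('a \<times> 'a) set" where
  "conn E = (E \<union> E\<inverse>)\<^sup>*"

lemma conn_refl [simp]: "(x, x) \<in> conn E"
  by (simp add: conn_def)

lemma conn_sym: "(x, y) \<in> conn E \<Longrightarrow> (y, x) \<in> conn E"
  unfolding conn_def
  by (rule symD[OF sym_rtrancl[OF sym_Un_converse]])

lemma conn_trans: "(x, y) \<in> conn E \<Longrightarrow> (y, z) \<in> conn E \<Longrightarrow> (x, z) \<in> conn E"
  unfolding conn_def by (rule rtrancl_trans)

lemma conn_edge: "(x, y) \<in> E \<Longrightarrow> (x, y) \<in> conn E"
  unfolding conn_def by blast

lemma conn_edge': "(y, x) \<in> E \<Longrightarrow> (x, y) \<in> conn E"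
  unfolding conn_def by blast

lemma conn_induct [consumes 1, case_names base step]:
  assumes "(x, y) \<in> conn E"
    and "P x"
    and "\<And>y z. (x, y) \<in> conn E \<Longrightarrow> (y, z) \<in> E \<or> (z, y) \<in> E \<Longrightarrow> P y \<Longrightarrow> P z"
  shows "P y"
  using assms(1) unfolding conn_def
  by (induction rule: rtrancl_induct) (use assms(2,3) in \<open>auto simp: conn_def\<close>)

lemma conn_mono: "E \<subseteq> F \<Longrightarrow> conn E \<subseteq> conn F"
  unfolding conn_def by (intro rtrancl_mono) blast

lemma conn_map:
  assumes "(x, y) \<in> conn E"
    and "\<And>u v. (u, v) \<in> E \<Longrightarrow> (f u, f v) \<in> conn F"
  shows "(f x, f y) \<in> conn F"
  using assms(1)
proof (induction rule: conn_induct)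
  case (step y z)
  then have "(f y, f z) \<in> conn F"
    using assms(2) conn_sym by fastforce
  with step.IH show ?case by (rule conn_trans)
qed simp

lemma conn_subset:
  assumes "\<And>u v. (u, v) \<in> E \<Longrightarrow> (u, v) \<in> conn F"
  shows "conn E \<subseteq> conn F"
  using conn_map[of _ _ E "\<lambda>x. x" F] assms by auto

lemma conn_cong:
  assumes "\<And>u v. (u, v) \<in> E \<Longrightarrow> (u, v) \<in> conn F"
    and "\<And>u v. (u, v) \<in> F \<Longrightarrow> (u, v) \<in> conn E"
  shows "conn E = conn F"
  by (intro equalityI conn_subset assms)

lemma conn_closed:
  assumes "(x, y) \<in> conn E" and "E \<subseteq> V \<times> V" and "x \<in> V"
  shows "y \<in> V"
  using assms by (induction rule: conn_induct) auto

text \<open>\<open>conn\<close> is not restricted to vertices, so it is monotone in the edges and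
  one relation serves several vertex sets; the restriction happens only here.\<close>

definition conn_class :: "'a set \<Rightarrow> ('a \<times> 'a) set \<Rightarrow> 'a \<Rightarrow> 'a set" where
  "conn_class V E x = {y \<in> V. (x, y) \<in> conn E}"

lemma conn_classes_eq: "conn_classes V E = conn_class V E ` V"
  unfolding conn_classes_def conn_class_def conn_def quotient_def by auto

lemma finite_conn_classes: "finite V \<Longrightarrow> finite (conn_classes V E)"
  by (simp add: conn_classes_eq)

lemma conn_class_eq_iff:
  assumes "x \<in> V" "y \<in> V"
  shows "conn_class V E x = conn_class V E y \<longleftrightarrow> (x, y) \<in> conn E"
proof
  assume "conn_class V E x = conn_class V E y"
  then have "y \<in> conn_class V E x"
    using assms by (simp add: conn_class_def)
  then show "(x, y) \<in> conn E" by (simp add: conn_class_def)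
next
  assume xy: "(x, y) \<in> conn E"
  show "conn_class V E x = conn_class V E y"
    unfolding conn_class_def
    using xy conn_trans[of x y E] conn_trans[of y x E] conn_sym[OF xy] by blast
qed

lemma conn_classes_memD:
  assumes "C \<in> conn_classes V E" "x \<in> C"
  shows "x \<in> V" "C = conn_class V E x"
proof -
  obtain z where "z \<in> V" "C = conn_class V E z" using assms(1) by (auto simp: conn_classes_eq)
  with assms(2) show "x \<in> V" "C = conn_class V E x"
    using conn_class_eq_iff[of z V x E] by (auto simp: conn_class_def)
qed

lemma conn_classes_mem_iff:
  "C \<in> conn_classes V E \<Longrightarrow> x \<in> C \<Longrightarrow> y \<in> C \<longleftrightarrow> y \<in> V \<and> (x, y) \<in> conn E"
  using conn_classes_memD(2) by (fastforce simp: conn_class_def)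

lemma conn_classes_disjoint:
  "C \<in> conn_classes V E \<Longrightarrow> C' \<in> conn_classes V E \<Longrightarrow> x \<in> C \<Longrightarrow> x \<in> C' \<Longrightarrow> C = C'"
  using conn_classes_memD(2) by metis

lemma conn_class_self: "x \<in> V \<Longrightarrow> x \<in> conn_class V E x \<and> conn_class V E x \<in> conn_classes V E"
  by (auto simp: conn_classes_eq conn_class_def)

lemma conn_classes_cong: "conn E = conn F \<Longrightarrow> conn_classes V E = conn_classes V F"
  by (simp add: conn_classes_eq conn_class_def)

lemma conn_classes_empty: "card (conn_classes V {}) = card V"
proof -
  have "inj_on (conn_class V {}) V"
    by (auto simp: inj_on_def conn_class_eq_iff conn_def)
  then show ?thesis by (simp add: conn_classes_eq card_image)
qed

text \<open>\<open>f\<close> acts on classes, and the equivalence makes this well defined and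
  injective. Classes that \<open>f\<close> misses stay uncounted, which later sets the free curves
  apart.\<close>

lemma card_conn_classes_meeting:
  assumes "f ` V \<subseteq> W"
    and "\<And>x y. x \<in> V \<Longrightarrow> y \<in> V \<Longrightarrow> (x, y) \<in> conn E \<longleftrightarrow> (f x, f y) \<in> conn F"
  shows "card (conn_classes V E) = card {C \<in> conn_classes W F. C \<inter> f ` V \<noteq> {}}"
proof -
  \<comment> \<open>The class of the image of an arbitrary representative; the fact \<open>h\<close>
    shows independence of the choice.\<close>
  define h where "h C = conn_class W F (f (SOME x. x \<in> V \<and> conn_class V E x = C))" for C
  have h: "h (conn_class V E x) = conn_class W F (f x)" if "x \<in> V" for x
  proof -
    define y where "y = (SOME y. y \<in> V \<and> conn_class V E y = conn_class V E x)"
    have y: "y \<in> V \<and> conn_class V E y = conn_class V E x"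
      unfolding y_def by (rule someI[of _ x]) (use that in simp)
    then have "(f y, f x) \<in> conn F"
      using assms(2)[of y x] that conn_class_eq_iff[of y V x E] by simp
    then show ?thesis
      unfolding h_def y_def[symmetric]
      using y that assms(1) by (subst conn_class_eq_iff) auto
  qed
  have inj: "inj_on h (conn_classes V E)"
  proof (rule inj_onI)
    fix C C' assume "C \<in> conn_classes V E" "C' \<in> conn_classes V E" and eq: "h C = h C'"
    then obtain x y where xy: "x \<in> V" "y \<in> V" "C = conn_class V E x" "C' = conn_class V E y"
      by (auto simp: conn_classes_eq)
    then have "(f x, f y) \<in> conn F"
      using eq assms(1) by (simp add: h conn_class_eq_iff image_subset_iff)
    then show "C = C'"
      using xy assms(2) by (simp add: conn_class_eq_iff)
  qed
  have "h ` conn_classes V E = {C \<in> conn_classes W F. C \<inter> f ` V \<noteq> {}}"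
  proof (intro equalityI subsetI)
    fix C assume "C \<in> h ` conn_classes V E"
    then obtain x where x: "x \<in> V" "C = conn_class W F (f x)"
      by (auto simp: conn_classes_eq h)
    moreover have "f x \<in> conn_class W F (f x)"
      using x assms(1) by (auto simp: conn_class_def)
    ultimately show "C \<in> {C \<in> conn_classes W F. C \<inter> f ` V \<noteq> {}}"
      using assms(1) by (auto simp: conn_classes_eq)
  next
    fix C assume "C \<in> {C \<in> conn_classes W F. C \<inter> f ` V \<noteq> {}}"
    then obtain w x where wx: "w \<in> W" "C = conn_class W F w" "x \<in> V" "f x \<in> C"
      by (auto simp: conn_classes_eq)
    then have "C = conn_class W F (f x)"
      using conn_class_eq_iff[of w W "f x" F] by (auto simp: conn_class_def)
    then show "C \<in> h ` conn_classes V E"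
      using wx h by (auto simp: conn_classes_eq image_iff intro!: bexI[of _ x])
  qed
  then show ?thesis
    using inj by (metis card_image)
qed

lemma card_conn_classes_transfer:
  assumes "f ` V \<subseteq> W"
    and "\<And>x y. x \<in> V \<Longrightarrow> y \<in> V \<Longrightarrow> (x, y) \<in> conn E \<longleftrightarrow> (f x, f y) \<in> conn F"
    and "\<And>w. w \<in> W \<Longrightarrow> \<exists>x\<in>V. (w, f x) \<in> conn F"
  shows "card (conn_classes V E) = card (conn_classes W F)"
proof -
  have "{C \<in> conn_classes W F. C \<inter> f ` V \<noteq> {}} = conn_classes W F"
  proof (intro equalityI subsetI CollectI conjI)
    fix C assume "C \<in> conn_classes W F"
    then obtain w where w: "w \<in> W" "C = conn_class W F w" by (auto simp: conn_classes_eq)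
    with assms(3) obtain x where "x \<in> V" "(w, f x) \<in> conn F" by blast
    with w assms(1) have "f x \<in> C \<inter> f ` V" by (auto simp: conn_class_def)
    then show "C \<inter> f ` V \<noteq> {}" by blast
  qed auto
  then show ?thesis
    using card_conn_classes_meeting[OF assms(1,2)] by simp
qed

section \<open>Adding edges to a graph\<close>

lemma conn_insert:
  "(x, y) \<in> conn (insert (a, b) E) \<longleftrightarrow>
     (x, y) \<in> conn E \<or> (x, a) \<in> conn E \<and> (b, y) \<in> conn E \<or> (x, b) \<in> conn E \<and> (a, y) \<in> conn E"
  (is "_ \<longleftrightarrow> ?R x y")
proof
  assume "(x, y) \<in> conn (insert (a, b) E)"
  then show "?R x y"
  \<comment> \<open>A walk needs the new edge at most once.\<close>
  proof (induction rule: conn_induct)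
    case (step y z)
    then consider "(y, z) \<in> conn E" | "y = a" "z = b" | "y = b" "z = a"
      by (auto intro: conn_edge conn_edge')
    then show ?case
      using step.IH conn_trans[of x y E z] conn_trans[of b y E z] conn_trans[of a y E z]
      by cases auto
  qed simp
next
  have E: "conn E \<subseteq> conn (insert (a, b) E)" by (rule conn_mono) blast
  have ab: "(a, b) \<in> conn (insert (a, b) E)" by (simp add: conn_edge)
  assume "?R x y"
  then show "(x, y) \<in> conn (insert (a, b) E)"
    using E ab by (meson conn_edge' conn_trans insertI1 subsetD)
qed

lemma conn_insert_redundant: "(a, b) \<in> conn E \<Longrightarrow> conn (insert (a, b) E) = conn E"
  by (rule conn_cong) (auto intro: conn_edge)

text \<open>The new edge can only fuse the classes of \<open>a\<close> and \<open>b\<close>; every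
  other class survives unchanged.\<close>

lemma card_conn_classes_insert:
  assumes "finite V" "a \<in> V" "b \<in> V"
  shows "card (conn_classes V (insert (a, b) E)) \<le> card (conn_classes V E)"
    and "card (conn_classes V E) \<le> Suc (card (conn_classes V (insert (a, b) E)))"
proof -
  let ?E = "insert (a, b) E"
  have E: "conn E \<subseteq> conn ?E" by (rule conn_mono) blast
  \<comment> \<open>Each old class lies in one new class, found through any of its points, so the
    new classes are an image of the old ones.\<close>
  have "conn_classes V ?E \<subseteq> (\<lambda>C. conn_class V ?E (SOME x. x \<in> C)) ` conn_classes V E"
  proof
    fix C assume "C \<in> conn_classes V ?E"
    then obtain x where x: "x \<in> V" "C = conn_class V ?E x" by (auto simp: conn_classes_eq)
    define y where "y = (SOME y. y \<in> conn_class V E x)"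
    have "y \<in> conn_class V E x"
      unfolding y_def by (rule someI[of _ x]) (use x in \<open>simp add: conn_class_def\<close>)
    then have "C = conn_class V ?E y"
      unfolding x(2) using x(1) E by (subst conn_class_eq_iff) (auto simp: conn_class_def)
    then show "C \<in> (\<lambda>C. conn_class V ?E (SOME x. x \<in> C)) ` conn_classes V E"
      using x(1) y_def by (auto simp: conn_classes_eq)
  qed
  then show "card (conn_classes V ?E) \<le> card (conn_classes V E)"
    using assms(1) by (meson finite_conn_classes surj_card_le)
  let ?A = "conn_class V ?E a"
  have A: "?A \<in> conn_classes V ?E" using assms by (auto simp: conn_classes_eq)
  \<comment> \<open>Removing the fused class and putting back the two old ones covers all old
    classes: minus one plus two gives the \<open>Suc\<close>.\<close>
  have "conn_classes V E \<subseteq> (conn_classes V ?E - {?A}) \<union> {conn_class V E a, conn_class V E b}"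
  proof
    fix C assume "C \<in> conn_classes V E"
    then obtain x where x: "x \<in> V" "C = conn_class V E x" by (auto simp: conn_classes_eq)
    show "C \<in> (conn_classes V ?E - {?A}) \<union> {conn_class V E a, conn_class V E b}"
    proof (cases "(x, a) \<in> conn E \<or> (x, b) \<in> conn E")
      case True
      then show ?thesis using x assms by (auto simp: conn_class_eq_iff)
    next
      case False
      then have "C = conn_class V ?E x"
        unfolding x(2) conn_class_def by (simp add: conn_insert)
      moreover have "(x, a) \<notin> conn ?E"
        using False by (simp add: conn_insert)
      ultimately show ?thesis
        using x(1) assms by (auto simp: conn_classes_eq conn_class_eq_iff)
    qed
  qed
  then have "card (conn_classes V E)
      \<le> card ((conn_classes V ?E - {?A}) \<union> {conn_class V E a, conn_class V E b})"
    using assms(1) by (intro card_mono) (auto simp: finite_conn_classes)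
  also have "\<dots> \<le> card (conn_classes V ?E - {?A}) + card {conn_class V E a, conn_class V E b}"
    by (rule card_Un_le)
  also have "\<dots> \<le> card (conn_classes V ?E - {?A}) + 2"
    by (simp add: card_insert_if)
  also have "\<dots> = Suc (card (conn_classes V ?E))"
    using A assms(1) card_Suc_Diff1[OF finite_conn_classes A] by simp
  finally show "card (conn_classes V E) \<le> Suc (card (conn_classes V ?E))" .
qed

lemma card_le_conn_classes_edges:
  assumes "finite V" "finite E" "E \<subseteq> V \<times> V"
  shows "card V \<le> card (conn_classes V E) + card E"
  using assms(2,3)
proof (induction rule: finite_induct)
  case empty
  then show ?case by (simp add: conn_classes_empty)
next
  case (insert e E)
  obtain a b where e: "e = (a, b)" by (cases e)
  show ?case
    using insert card_conn_classes_insert(2)[OF assms(1), of a b E] by (auto simp: e)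
qed

text \<open>A connected graph has at least the edges of a spanning tree. Edges never leave
  \<open>C\<close>, so testing the first endpoint finds exactly those inside
  \<open>C\<close>.\<close>

lemma card_conn_class_le:
  assumes "finite V" "finite E" "E \<subseteq> V \<times> V" "C \<in> conn_classes V E"
  shows "card C \<le> Suc (card {e \<in> E. fst e \<in> C})"
proof -
  obtain x where x: "x \<in> V" "C = conn_class V E x"
    using assms(4) by (auto simp: conn_classes_eq)
  let ?F = "{e \<in> E. fst e \<in> C}"
  have fwd: "v \<in> C" if "(u, v) \<in> E" "u \<in> C" for u v
    using that assms(3) conn_trans[OF _ conn_edge] by (auto simp: x conn_class_def)
  have bwd: "u \<in> C" if "(u, v) \<in> E" "v \<in> C" for u v
    using that assms(3) conn_trans[OF _ conn_sym[OF conn_edge]]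
    by (auto simp: x conn_class_def)
  have reach: "y \<in> C \<and> (x, y) \<in> conn ?F" if "(x, y) \<in> conn E" for y
    using that
  proof (induction rule: conn_induct)
    case base
    then show ?case using x by (simp add: conn_class_def)
  next
    case (step y z)
    then have "((y, z) \<in> ?F \<or> (z, y) \<in> ?F) \<and> z \<in> C"
      using fwd bwd by auto
    with step.IH show ?case by (meson conn_trans conn_edge conn_edge')
  qed
  have "conn_class C ?F y = C" if "y \<in> C" for y
  proof -
    have "(y, z) \<in> conn ?F" if "z \<in> C" for z
    proof -
      have "(x, y) \<in> conn E" "(x, z) \<in> conn E"
        using \<open>y \<in> C\<close> that by (auto simp: x conn_class_def)
      then show ?thesis
        by (intro conn_trans[OF conn_sym[OF conjunct2[OF reach]] conjunct2[OF reach]])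
    qed
    then show ?thesis by (auto simp: conn_class_def)
  qed
  then have "conn_classes C ?F \<subseteq> {C}" by (auto simp: conn_classes_eq)
  then have "card (conn_classes C ?F) \<le> 1"
    by (metis card_mono finite.intros One_nat_def card.empty card_insert_disjoint empty_iff)
  moreover have "C \<subseteq> V" by (auto simp: x conn_class_def)
  then have "card C \<le> card (conn_classes C ?F) + card ?F"
    using assms fwd by (intro card_le_conn_classes_edges) (auto intro: finite_subset)
  ultimately show ?thesis by simp
qed

text \<open>Any three of the four sides of a quadrilateral connect the same vertices as all four.\<close>

lemma card_conn_classes_quadrilateral:
  assumes "finite V" "a \<in> V" "b \<in> V" "c \<in> V" "d \<in> V"
  shows "card (conn_classes V ({(a, b), (c, d)} \<union> E))
    \<le> Suc (card (conn_classes V ({(b, c), (d, a)} \<union> E)))"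
proof -
  let ?E1 = "{(a, b), (c, d)} \<union> E" and ?E2 = "{(b, c), (d, a)} \<union> E"
  have "conn (insert (b, c) ?E1) = conn (insert (a, b) ?E2)"
  proof (rule conn_cong)
    fix u v assume "(u, v) \<in> insert (b, c) ?E1"
    moreover have "(c, d) \<in> conn (insert (a, b) ?E2)"
      by (rule conn_trans[of _ b], rule conn_edge', force, rule conn_trans[of _ a],
          rule conn_edge', force, rule conn_edge', force)
    ultimately show "(u, v) \<in> conn (insert (a, b) ?E2)"
      by (auto intro: conn_edge)
  next
    fix u v assume "(u, v) \<in> insert (a, b) ?E2"
    moreover have "(d, a) \<in> conn (insert (b, c) ?E1)"
      by (rule conn_trans[of _ c], rule conn_edge', force, rule conn_trans[of _ b],
          rule conn_edge', force, rule conn_edge', force)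
    ultimately show "(u, v) \<in> conn (insert (b, c) ?E1)"
      by (auto intro: conn_edge)
  qed
  then have "card (conn_classes V (insert (b, c) ?E1)) = card (conn_classes V (insert (a, b) ?E2))"
    by (simp add: conn_classes_eq conn_class_def)
  moreover have "card (conn_classes V ?E1) \<le> Suc (card (conn_classes V (insert (b, c) ?E1)))"
    using assms by (intro card_conn_classes_insert)
  moreover have "card (conn_classes V (insert (a, b) ?E2)) \<le> card (conn_classes V ?E2)"
    using assms by (intro card_conn_classes_insert)
  ultimately show ?thesis by simp
qed

text \<open>A walk in a class disjoint from \<open>X\<close> never uses an edge of \<open>M\<close>.
  This identifies the curves without real crossings in \<open>D\<close> and in its states.\<close>

lemma conn_classes_missing:
  assumes "N \<subseteq> V \<times> V" "M \<subseteq> X \<times> X"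
  shows "{C \<in> conn_classes V (N \<union> M). C \<inter> X = {}} = {C \<in> conn_classes V N. C \<inter> X = {}}"
proof -
  have NM: "conn N \<subseteq> conn (N \<union> M)" by (rule conn_mono) blast
  have eq: "conn_class V (N \<union> M) x = conn_class V N x"
    if x: "x \<in> V" "conn_class V N x \<inter> X = {}" for x
  proof -
    have "(x, y) \<in> conn N \<and> y \<in> V" if "(x, y) \<in> conn (N \<union> M)" for y
      using that
    proof (induction rule: conn_induct)
      case (step y z)
      then have "y \<notin> X" using x by (auto simp: conn_class_def)
      then have "(y, z) \<in> N \<or> (z, y) \<in> N" using step.hyps(2) assms by auto
      then show ?case using step.IH assms by (meson conn_trans conn_edge conn_edge' mem_Sigma_iff subsetD)
    qed (use x in simp)
    with NM show ?thesis by (auto simp: conn_class_def)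
  qed
  have "conn_class V N x \<subseteq> conn_class V (N \<union> M) x" for x
    using NM by (auto simp: conn_class_def)
  with eq show ?thesis
    unfolding conn_classes_eq by (safe; fastforce)
qed

lemma conn_Un_cong: "conn E = conn F \<Longrightarrow> conn (X \<union> E) = conn (X \<union> F)"
proof -
  have *: "(u, v) \<in> conn (X \<union> F)" if "conn E = conn F" "(u, v) \<in> X \<union> E" for E F u v
  proof (cases "(u, v) \<in> X")
    case True
    then show ?thesis by (simp add: conn_edge)
  next
    case False
    with that(2) have "(u, v) \<in> conn E" by (simp add: conn_edge)
    then show ?thesis using conn_mono[of F "X \<union> F"] unfolding that(1) by auto
  qed
  assume "conn E = conn F"
  with *[of E F] *[of F E] show ?thesis by (intro conn_cong) auto
qed

lemma conn_symcl: "E \<union> E\<inverse> = F \<union> F\<inverse> \<Longrightarrow> conn E = conn F"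
  by (simp add: conn_def)

section \<open>A recursive form of the bracket\<close>

definition verts :: "('a \<times> 'a) list \<Rightarrow> 'a set" where
  "verts ps = fst ` set ps \<union> snd ` set ps"

lemma verts_simps [simp]:
  "verts [] = {}" "verts ((a, b) # ps) = insert a (insert b (verts ps))"
  "verts (ps @ qs) = verts ps \<union> verts qs"
  by (auto simp: verts_def)

lemma finite_verts [simp]: "finite (verts ps)"
  by (simp add: verts_def)

lemma verts_map: "verts (map (map_prod f f) ps) = f ` verts ps"
  by (force simp: verts_def)

lemma edges_subset_verts: "set ps \<subseteq> verts ps \<times> verts ps"
  by (force simp: verts_def)

text \<open>Vertices are labels and edges are strands, so curves are components. Every vertex lies
  on some pair; a loop \<open>(e, e)\<close> stands for a circle.\<close>

definition ncomp :: "('a \<times> 'a) list \<Rightarrow> nat" where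
  "ncomp ps = card (conn_classes (verts ps) (set ps))"

lemma ncomp_pos: "ps \<noteq> [] \<Longrightarrow> ncomp ps > 0"
  by (cases ps) (auto simp: ncomp_def card_gt_0_iff finite_conn_classes conn_classes_eq)

lemma ncomp_circle:
  assumes "e \<notin> verts ps"
  shows "ncomp ((e, e) # ps) = Suc (ncomp ps)"
proof -
  have conn: "conn (set ((e, e) # ps)) = conn (set ps)"
    using conn_insert_redundant[OF conn_refl] by simp
  have e: "conn_class (insert e (verts ps)) (set ps) e = {e}"
  proof -
    have "y = e" if "(e, y) \<in> conn (set ps)" for y
      using that edges_subset_verts[of ps] assms by (induction rule: conn_induct) auto
    then show ?thesis by (auto simp: conn_class_def)
  qed
  have "conn_class (insert e (verts ps)) (set ps) x = conn_class (verts ps) (set ps) x"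
    if "x \<in> verts ps" for x
    using conn_closed[of x e "set ps" "verts ps"] edges_subset_verts[of ps] that assms
    by (auto simp: conn_class_def)
  then have "conn_classes (verts ((e, e) # ps)) (set ((e, e) # ps))
      = insert {e} (conn_classes (verts ps) (set ps))"
    using e unfolding conn_classes_cong[OF conn] by (simp add: conn_classes_eq)
  moreover have "{e} \<notin> conn_classes (verts ps) (set ps)"
    using assms by (auto simp: conn_classes_eq conn_class_def)
  ultimately show ?thesis
    by (simp add: ncomp_def finite_conn_classes)
qed

lemma ncomp_subdivide:
  assumes "e \<notin> verts ps" "e \<noteq> x" "e \<noteq> y"
  shows "ncomp ((x, e) # (e, y) # ps) = ncomp ((x, y) # ps)"
proof -
  let ?E = "set ((x, y) # ps)" and ?F = "set ((x, e) # (e, y) # ps)"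
  have xy: "(x, y) \<in> conn ?F"
    by (rule conn_trans[of _ e]; rule conn_edge) auto
  have "card (conn_classes (verts ((x, y) # ps)) ?E)
      = card (conn_classes (verts ((x, e) # (e, y) # ps)) ?F)"
  proof (rule card_conn_classes_transfer[where f = "\<lambda>v. v"])
    fix u v assume uv: "u \<in> verts ((x, y) # ps)" "v \<in> verts ((x, y) # ps)"
    then have ne: "u \<noteq> e" "v \<noteq> e" using assms by auto
    show "(u, v) \<in> conn ?E \<longleftrightarrow> (u, v) \<in> conn ?F"
    proof
      show "(u, v) \<in> conn ?F" if "(u, v) \<in> conn ?E"
        using that conn_subset[of ?E ?F] xy by (auto intro: conn_edge)
      assume "(u, v) \<in> conn ?F"
      \<comment> \<open>Retracting \<open>e\<close> to \<open>x\<close> collapses the first half of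
        the subdivided edge and maps the second to \<open>(x, y)\<close>.\<close>
      then have "((id(e := x)) u, (id(e := x)) v) \<in> conn ?E"
      proof (rule conn_map)
        fix a b assume "(a, b) \<in> ?F"
        then show "((id(e := x)) a, (id(e := x)) b) \<in> conn ?E"
          using assms edges_subset_verts[of ps] by (auto intro: conn_edge)
      qed
      then show "(u, v) \<in> conn ?E" using ne by simp
    qed
  next
    fix w assume "w \<in> verts ((x, e) # (e, y) # ps)"
    moreover have "(e, x) \<in> conn ?F" by (rule conn_edge') simp
    ultimately show "\<exists>v\<in>verts ((x, y) # ps). (w, v) \<in> conn ?F"
      by (cases "w = e") (auto intro: bexI[of _ w])
  qed auto
  then show ?thesis by (simp add: ncomp_def)
qed

lemma ncomp_rename:
  assumes "inj_on f (verts ps)"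
  shows "ncomp (map (map_prod f f) ps) = ncomp ps"
  unfolding ncomp_def
proof (rule card_conn_classes_transfer[where f = f, symmetric])
  fix x y assume xy: "x \<in> verts ps" "y \<in> verts ps"
  let ?E = "set ps" and ?F = "set (map (map_prod f f) ps)"
  show "(x, y) \<in> conn ?E \<longleftrightarrow> (f x, f y) \<in> conn ?F"
  proof
    show "(f x, f y) \<in> conn ?F" if "(x, y) \<in> conn ?E"
      using that by (rule conn_map) (auto intro!: conn_edge intro: rev_image_eqI)
    assume "(f x, f y) \<in> conn ?F"
    then have "(inv_into (verts ps) f (f x), inv_into (verts ps) f (f y)) \<in> conn ?E"
      by (rule conn_map)
        (use edges_subset_verts[of ps] assms in \<open>auto intro!: conn_edge\<close>)
    then show "(x, y) \<in> conn ?E" using xy assms by simp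
  qed
next
  fix w assume "w \<in> verts (map (map_prod f f) ps)"
  then obtain x where "x \<in> verts ps" "w = f x" by (auto simp: verts_map)
  then show "\<exists>x\<in>verts ps. (w, f x) \<in> conn (set (map (map_prod f f) ps))"
    by (auto intro!: bexI[of _ x])
qed (auto simp: verts_map)

text \<open>\<open>f\<close> moves each vertex within its class. If neither \<open>a\<close> nor
  \<open>b\<close> occurred in \<open>ps\<close>, the renamed list would lose the merged vertex and
  with it a component.\<close>

lemma ncomp_contract:
  assumes "a \<noteq> b" and "{a, b} \<inter> verts ps \<noteq> {}" and f: "f = id(b := a)"
  shows "ncomp (map (map_prod f f) ps) = ncomp ((a, b) # ps)"
  unfolding ncomp_def
proof (rule card_conn_classes_transfer[where f = f, symmetric])
  let ?E = "set ((a, b) # ps)" and ?F = "set (map (map_prod f f) ps)"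
  have fx: "(x, f x) \<in> conn ?E" for x
    by (auto simp: f intro: conn_edge')
  show "f ` verts ((a, b) # ps) \<subseteq> verts (map (map_prod f f) ps)"
    using assms(2) by (auto simp: verts_map f intro: rev_image_eqI)
  fix x y
  show "(x, y) \<in> conn ?E \<longleftrightarrow> (f x, f y) \<in> conn ?F"
  proof
    show "(f x, f y) \<in> conn ?F" if "(x, y) \<in> conn ?E"
      using that
    proof (rule conn_map)
      fix u v assume "(u, v) \<in> ?E"
      then consider "u = a" "v = b" | "(u, v) \<in> set ps" by auto
      then show "(f u, f v) \<in> conn ?F"
      proof cases
        case 2
        then show ?thesis by (intro conn_edge) (auto intro: rev_image_eqI)
      qed (simp add: f)
    qed
    assume "(f x, f y) \<in> conn ?F"
    then have "(f x, f y) \<in> conn ?E"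
    proof (rule conn_map[where f = "\<lambda>v. v"])
      fix u v assume "(u, v) \<in> ?F"
      then obtain u' v' where "(u', v') \<in> set ps" "u = f u'" "v = f v'" by auto
      then show "(u, v) \<in> conn ?E"
        using conn_trans[OF conn_trans[OF conn_sym[OF fx] conn_edge] fx, of u' v'] by simp
    qed
    then show "(x, y) \<in> conn ?E"
      using fx conn_sym conn_trans by meson
  qed
next
  fix w assume "w \<in> verts (map (map_prod f f) ps)"
  then obtain x where "x \<in> verts ps" "w = f x" by (auto simp: verts_map)
  then show "\<exists>x\<in>verts ((a, b) # ps). (w, f x) \<in> conn (set (map (map_prod f f) ps))"
    by (intro bexI[of _ x]) auto
qed

text \<open>Splicing and listing strands in one step. On virtual crossings and joints both splice
  types agree, so \<open>br\<close> may use \<open>ASplice\<close> there.\<close>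

fun smooth :: "splice_type \<Rightarrow> 'e node \<Rightarrow> ('e \<times> 'e) list" where
  "smooth ASplice (Crossing Under a b c d) = [(a, b), (c, d)]"
| "smooth BSplice (Crossing Under a b c d) = [(b, c), (d, a)]"
| "smooth ASplice (Crossing Over a b c d) = [(b, c), (d, a)]"
| "smooth BSplice (Crossing Over a b c d) = [(a, b), (c, d)]"
| "smooth t (Crossing Virtual a b c d) = [(a, c), (b, d)]"
| "smooth t (Joint a b) = [(a, b)]"

lemma verts_smooth: "verts (smooth t n) = edges n"
  by (cases "(t, n)" rule: smooth.cases) auto

lemma smooth_map: "smooth t (map_node f n) = map (map_prod f f) (smooth t n)"
  by (cases "(t, n)" rule: smooth.cases) auto

lemma is_real_map [simp]: "is_real (map_node f n) = is_real n"
  by (cases n) auto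

definition circle_value :: laurent_poly where
  "circle_value = - A_power 2 - A_power (- 2)"

lemma A_power_mult: "A_power m * A_power n = A_power (m + n)"
  by (simp add: A_power_def mult_single)

lemma A_power_0 [simp]: "A_power 0 = 1"
  by (simp add: A_power_def)

text \<open>The list \<open>ps\<close> collects the strands of the part of the diagram that has been resolved.\<close>

fun br :: "diagram \<Rightarrow> (nat \<times> nat) list \<Rightarrow> laurent_poly" where
  "br [] ps = circle_value ^ (ncomp ps - 1)"
| "br (n # D) ps =
    (if is_real n
     then A_power 1 * br D (smooth ASplice n @ ps) + A_power (- 1) * br D (smooth BSplice n @ ps)
     else br D (smooth ASplice n @ ps))"

text \<open>Resolved strands matter only through their connectivity and their vertices, and both
  kinds of agreement survive the addition of further strands.\<close>

lemma br_cong: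
  assumes "conn (set ps) = conn (set qs)" "verts ps = verts qs"
  shows "br D ps = br D qs"
  using assms
proof (induction D arbitrary: ps qs)
  case Nil
  then show ?case by (simp add: ncomp_def conn_classes_cong[OF Nil.prems(1)])
next
  case (Cons n D)
  have "br D (xs @ ps) = br D (xs @ qs)" for xs
    by (rule Cons.IH) (use Cons.prems conn_Un_cong[OF Cons.prems(1)] in auto)
  then show ?case by simp
qed

lemma br_symcl:
  assumes "set ps \<union> (set ps)\<inverse> = set qs \<union> (set qs)\<inverse>"
  shows "br D ps = br D qs"
proof (rule br_cong)
  show "conn (set ps) = conn (set qs)" using assms by (rule conn_symcl)
  have "verts ps = fst ` (set ps \<union> (set ps)\<inverse>)" for ps :: "(nat \<times> nat) list"
    by (force simp: verts_def)
  then show "verts ps = verts qs" using assms by simp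
qed

lemma br_set: "set ps = set qs \<Longrightarrow> br D ps = br D qs"
  by (rule br_symcl) simp

lemma br_swap: "br (m # n # D) ps = br (n # m # D) ps"
proof -
  have "br D (xs @ ys @ ps) = br D (ys @ xs @ ps)" for xs ys
    by (rule br_set) auto
  then show ?thesis by (simp add: algebra_simps)
qed

lemma br_move_front: "br (E @ n # F) ps = br (n # E @ F) ps"
proof (induction E arbitrary: ps)
  case (Cons m E)
  have "br ((m # E) @ n # F) ps = br (m # n # E @ F) ps" by (simp add: Cons.IH)
  then show ?case by (simp only: br_swap[of m] append_Cons)
qed simp

lemma br_mset: "mset D = mset E \<Longrightarrow> br D ps = br E ps"
proof (induction D arbitrary: E ps)
  case (Cons n D)
  then have "n \<in> set E" by (metis list.set_intros(1) mset_eq_setD)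
  then obtain E1 E2 where E: "E = E1 @ n # E2" by (meson split_list)
  then have "mset D = mset (E1 @ E2)" using Cons.prems by simp
  then have "br D qs = br (E1 @ E2) qs" for qs by (rule Cons.IH)
  then show ?case unfolding E br_move_front by simp
qed simp

section \<open>Replacing tangles inside a diagram\<close>

lemma labels_simps [simp]:
  "labels [] = {}" "labels (n # D) = edges n \<union> labels D" "labels (D @ E) = labels D \<union> labels E"
  by (auto simp: labels_def)

text \<open>Resolving the rest of the diagram only enlarges \<open>ps\<close> by strands that avoid
  the inner labels \<open>I\<close>, so a relation between curve counts valid for every surrounding
  \<open>ps\<close> passes to \<open>br\<close>.\<close>

lemma br_tangle:
  assumes "\<And>ps. verts ps \<inter> I = {} \<Longrightarrow>
      circle_value ^ (ncomp (T @ ps) - 1) = u * circle_value ^ (ncomp (T' @ ps) - 1)"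
    and "verts ps \<inter> I = {}" "labels D \<inter> I = {}"
  shows "br D (T @ ps) = u * br D (T' @ ps)"
  using assms(2,3)
proof (induction D arbitrary: ps)
  case Nil
  then show ?case using assms(1) by simp
next
  case (Cons n D)
  have swap: "br D (xs @ T @ ps) = br D (T @ xs @ ps)" for xs T
    by (rule br_set) auto
  have "br D (T @ smooth t n @ ps) = u * br D (T' @ smooth t n @ ps)" for t
    by (rule Cons.IH) (use Cons.prems in \<open>auto simp: verts_smooth\<close>)
  then show ?case by (simp add: swap algebra_simps)
qed

text \<open>The strand \<open>p\<close> guarantees another curve: with none, the truncated exponent
  \<open>ncomp - 1\<close> would stay 0 and no factor would appear.\<close>

lemma br_circle:
  assumes "e \<notin> labels D" "e \<notin> verts (p # ps)"
  shows "br D ((e, e) # p # ps) = circle_value * br D (p # ps)"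
proof -
  have "br D ([(e, e), p] @ ps) = circle_value * br D ([p] @ ps)"
  proof (rule br_tangle[where I = "{e}"])
    fix qs assume "verts qs \<inter> {e} = {}"
    then have "ncomp ([(e, e), p] @ qs) = Suc (ncomp ([p] @ qs))"
      using assms(2) by (cases p) (auto intro!: ncomp_circle)
    moreover have "ncomp ([p] @ qs) > 0" by (rule ncomp_pos) simp
    then have "ncomp ([p] @ qs) = Suc (ncomp ([p] @ qs) - 1)" by simp
    ultimately show "circle_value ^ (ncomp ([(e, e), p] @ qs) - 1)
        = circle_value * circle_value ^ (ncomp ([p] @ qs) - 1)"
      by (metis diff_Suc_1 power_Suc)
  qed (use assms in \<open>cases p; auto\<close>)+
  then show ?thesis by simp
qed

lemma br_subdivide:
  assumes "e \<notin> labels D" "e \<notin> verts ps" "e \<noteq> x" "e \<noteq> y"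
  shows "br D ((x, e) # (e, y) # ps) = br D ((x, y) # ps)"
proof -
  have "br D ([(x, e), (e, y)] @ ps) = 1 * br D ([(x, y)] @ ps)"
    by (rule br_tangle[where I = "{e}"]) (use assms in \<open>auto simp: ncomp_subdivide\<close>)
  then show ?thesis by simp
qed

lemma br_rename:
  assumes "inj_on f (labels D \<union> verts ps)"
  shows "br (map (map_node f) D) (map (map_prod f f) ps) = br D ps"
  using assms
proof (induction D arbitrary: ps)
  case Nil
  then show ?case by (simp add: ncomp_rename)
next
  case (Cons n D)
  have "br (map (map_node f) D) (map (map_prod f f) (smooth t n @ ps)) = br D (smooth t n @ ps)"
    for t
    by (rule Cons.IH) (use Cons.prems in \<open>auto simp: verts_smooth Un_ac\<close>)
  then show ?case by (simp add: smooth_map)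
qed

lemma br_contract:
  assumes "a \<noteq> b" "{a, b} \<inter> (labels D \<union> verts ps) \<noteq> {}" and f: "f = id(b := a)"
  shows "br (map (map_node f) D) (map (map_prod f f) ps) = br D ((a, b) # ps)"
  using assms(2)
proof (induction D arbitrary: ps)
  case Nil
  then show ?case using ncomp_contract[OF assms(1) _ f] by simp
next
  case (Cons n D)
  have "br (map (map_node f) D) (map (map_prod f f) (smooth t n @ ps))
      = br D ((a, b) # smooth t n @ ps)" for t
    by (rule Cons.IH) (use Cons.prems in \<open>auto simp: verts_smooth\<close>)
  moreover have "br D ((a, b) # xs @ ps) = br D (xs @ (a, b) # ps)" for xs
    by (rule br_set) auto
  ultimately show ?case by (simp add: smooth_map)
qed

section \<open>Invariance of the span\<close>

fun neighbours :: "'a \<Rightarrow> ('a \<times> 'a) list \<Rightarrow> 'a list" where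
  "neighbours e [] = []"
| "neighbours e ((u, v) # T) =
    (if u = e then v # neighbours e T else if v = e then u # neighbours e T else neighbours e T)"

fun without :: "'a \<Rightarrow> ('a \<times> 'a) list \<Rightarrow> ('a \<times> 'a) list" where
  "without e [] = []"
| "without e ((u, v) # T) = (if u = e \<or> v = e then without e T else (u, v) # without e T)"

text \<open>Each inner label in turn must have exactly two neighbours, which are then joined
  directly; at the end strands are compared without orientation. Given the inequalities between
  labels, plain simplification decides it.\<close>

fun reduces :: "'a list \<Rightarrow> ('a \<times> 'a) list \<Rightarrow> ('a \<times> 'a) list \<Rightarrow> bool" where
  "reduces [] T T' \<longleftrightarrow>
    (\<forall>(u, v)\<in>set T. (u, v) \<in> set T' \<or> (v, u) \<in> set T') \<and>
    (\<forall>(u, v)\<in>set T'. (u, v) \<in> set T \<or> (v, u) \<in> set T)"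
| "reduces (e # es) T T' \<longleftrightarrow>
    (case neighbours e T of
       [x, y] \<Rightarrow> x \<noteq> e \<and> y \<noteq> e \<and> reduces es ((x, y) # without e T) T'
     | _ \<Rightarrow> False)"

lemma split_off_vertex:
  "set T \<union> (set T)\<inverse> =
     set (map (\<lambda>x. (e, x)) (neighbours e T) @ without e T)
     \<union> (set (map (\<lambda>x. (e, x)) (neighbours e T) @ without e T))\<inverse>"
  by (induction T rule: neighbours.induct) (auto split: if_splits)

lemma vertex_not_in_without: "e \<notin> verts (without e T)"
  by (induction T rule: without.induct) auto

text \<open>Each elimination is a subdivision read backwards. Labels in \<open>es\<close> must be
  absent from \<open>D\<close>, whose nodes could otherwise attach further strands to them.\<close>

lemma br_reduces:
  assumes "reduces es T T'" "set es \<inter> labels D = {}"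
  shows "br D T = br D T'"
  using assms
proof (induction es arbitrary: T)
  case Nil
  then have "set T \<union> (set T)\<inverse> = set T' \<union> (set T')\<inverse>" by fastforce
  then show ?case by (rule br_symcl)
next
  case (Cons e es)
  then obtain x y where xy: "neighbours e T = [x, y]" "x \<noteq> e" "y \<noteq> e"
      "reduces es ((x, y) # without e T) T'"
    by (auto split: list.splits)
  have "br D T = br D ((x, e) # (e, y) # without e T)"
    by (rule br_symcl, subst split_off_vertex[of T e]) (auto simp: xy(1))
  also have "\<dots> = br D ((x, y) # without e T)"
    using Cons.prems xy vertex_not_in_without[of e T] by (intro br_subdivide) auto
  also have "\<dots> = br D T'"
    using Cons.prems xy by (intro Cons.IH) auto
  finally show ?case .
qed

text \<open>One inner label is not eliminated but kept as a loop; it represents the circle that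
  splits off.\<close>

lemma br_reduces_circle:
  assumes "reduces es T ((e, e) # p # ps)" "set es \<inter> labels D = {}"
    and "e \<notin> labels D" "e \<notin> verts (p # ps)"
  shows "br D T = circle_value * br D (p # ps)"
  using br_reduces[OF assms(1,2)] br_circle[OF assms(3,4)] by simp

text \<open>The factor is a unit of the Laurent ring, A^m up to sign. Real kinks contribute -A^3 or
  -A^(-3); the other moves leave \<open>br\<close> unchanged.\<close>

definition unit_multiple :: "laurent_poly \<Rightarrow> laurent_poly \<Rightarrow> bool" where
  "unit_multiple f g \<longleftrightarrow> (\<exists>m c. (c = 1 \<or> c = - 1) \<and> g = Poly_Mapping.single m c * f)"

lemma unit_multiple_refl: "unit_multiple f f"
  unfolding unit_multiple_def
  by (intro exI[of _ 0] exI[of _ 1]) simp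

text \<open>\<open>a\<close> and \<open>b\<close> stand for A and its inverse. Keeping them abstract
  lets the kink identity serve both kinds of crossing by exchanging the two.\<close>

context
  fixes a b d :: "'r :: comm_ring_1"
  assumes ab: "a * b = 1" and d: "d = - (a * a) - b * b"
begin

lemma ab_cancel: "a * (b * z) = z"
  by (simp add: ab flip: mult.assoc)

lemma skein_R1: "a * x + b * (d * x) = - (b * b * b) * x"
  by (simp add: d ab_cancel algebra_simps)

text \<open>The coefficient of \<open>x\<close> is a * a + d + b * b = 0, that of \<open>y\<close>
  is a * b = 1.\<close>

lemma skein_R2: "a * (a * x + b * y) + b * (a * (d * x) + b * x) = y"
  by (simp add: d ab_cancel algebra_simps)

text \<open>The two sides exchange \<open>q\<close> and \<open>r\<close>. On the left of the first
  identity \<open>r\<close> collects a + a + b * d + b * b * b = a, which is also the coefficient of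
  \<open>q\<close>; in the second both are \<open>b\<close>. The identities belong to
  \<open>k' = Over\<close> and \<open>k' = Under\<close>.\<close>

lemma skein_R3:
  "a * (a * (a * p + b * r) + b * (a * q + b * u)) + b * (a * (a * r + b * (d * r)) + b * (a * s + b * r))
    = a * (a * (a * p + b * q) + b * (a * r + b * u)) + b * (a * (a * q + b * (d * q)) + b * (a * s + b * q))"
  "a * (a * (a * r + b * p) + b * (a * u + b * q)) + b * (a * (a * (d * r) + b * r) + b * (a * r + b * s))
    = a * (a * (a * q + b * p) + b * (a * u + b * r)) + b * (a * (a * (d * q) + b * q) + b * (a * q + b * s))"
  by (simp_all add: d ab_cancel algebra_simps)

end

section \<open>The bracket under the Reidemeister moves\<close>

lemma A_power_inverse: "A_power 1 * A_power (- 1) = 1" "A_power (- 1) * A_power 1 = 1"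
  by (simp_all add: A_power_mult)

lemma circle_value_eq:
  "circle_value = - (A_power 1 * A_power 1) - A_power (- 1) * A_power (- 1)"
  "circle_value = - (A_power (- 1) * A_power (- 1)) - A_power 1 * A_power 1"
  by (simp_all add: A_power_mult circle_value_def)

lemma minus_A_power: "- A_power m = Poly_Mapping.single m (- 1)"
  by (simp add: A_power_def single_uminus)

text \<open>One splice opens the kink, the other splits off a circle; \<open>Over\<close> gives the
  factor -A^(-3), \<open>Under\<close> gives -A^3.\<close>

lemma br_R1:
  assumes "c \<notin> labels D" "c \<noteq> a" "c \<noteq> b"
  shows "unit_multiple (br (Joint a b # D) []) (br (Crossing k a b c c # D) [])"
proof -
  let ?X = "br D [(a, b)]"
  have open_loop: "br D [(b, c), (c, a)] = ?X"
    by (rule br_reduces[where es = "[c]"]) (use assms in auto)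
  have closed_loop: "br D [(a, b), (c, c)] = circle_value * ?X"
    by (rule br_reduces_circle[where es = "[]" and e = c]) (use assms in auto)
  have virtual: "br D [(a, c), (b, c)] = ?X"
    by (rule br_reduces[where es = "[c]"]) (use assms in auto)
  show ?thesis
  proof (cases k)
    case Over
    have "A_power 1 * ?X + A_power (- 1) * (circle_value * ?X) = Poly_Mapping.single (- 3) (- 1) * ?X"
      using skein_R1[OF A_power_inverse(1) circle_value_eq(1), of ?X]
      by (simp add: A_power_mult flip: minus_A_power)
    then show ?thesis
      using Over by (auto simp: unit_multiple_def open_loop closed_loop)
  next
    case Under
    have "A_power 1 * (circle_value * ?X) + A_power (- 1) * ?X = Poly_Mapping.single 3 (- 1) * ?X"
      using skein_R1[OF A_power_inverse(2) circle_value_eq(2), of ?X]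
      by (simp add: A_power_mult add.commute flip: minus_A_power)
    then show ?thesis
      using Under by (auto simp: unit_multiple_def open_loop closed_loop)
  next
    case Virtual
    then show ?thesis by (simp add: virtual unit_multiple_refl)
  qed
qed

text \<open>For \<open>Over\<close>, the states \<open>AA\<close>, \<open>BA\<close>,
  \<open>BB\<close> all give the turn-back tangle \<open>?X\<close>, and their coefficients A^2, the
  circle value and A^(-2) cancel; only \<open>AB\<close> survives.\<close>

lemma br_R2:
  assumes "k \<noteq> Under" "e \<noteq> f" "{e, f} \<inter> ({a, b, c, d} \<union> labels D) = {}"
  shows "br (Crossing k a c e f # Crossing k e d b f # D) [] = br (Joint a b # Joint c d # D) []"
proof -
  let ?X = "br D [(a, c), (b, d)]"
  \<comment> \<open>Both orientations of each inequality, since evaluating \<open>reduces\<close>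
    compares labels in either order.\<close>
  have new: "e \<noteq> f" "f \<noteq> e" "e \<notin> labels D" "f \<notin> labels D"
      "e \<noteq> a" "e \<noteq> b" "e \<noteq> c" "e \<noteq> d" "a \<noteq> e" "b \<noteq> e" "c \<noteq> e" "d \<noteq> e"
      "f \<noteq> a" "f \<noteq> b" "f \<noteq> c" "f \<noteq> d" "a \<noteq> f" "b \<noteq> f" "c \<noteq> f" "d \<noteq> f"
    using assms(2,3) by auto
  have AA: "br D [(d, b), (f, e), (c, e), (f, a)] = ?X"
    by (rule br_reduces[where es = "[e, f]"]) (simp_all add: new)
  have AB: "br D [(e, d), (b, f), (c, e), (f, a)] = br D [(a, b), (c, d)]"
    by (rule br_reduces[where es = "[e, f]"]) (simp_all add: new)
  have BA: "br D [(d, b), (f, e), (a, c), (e, f)] = circle_value * ?X"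
    by (rule br_reduces_circle[where es = "[e]" and e = f]) (simp_all add: new)
  have BB: "br D [(e, d), (b, f), (a, c), (e, f)] = ?X"
    by (rule br_reduces[where es = "[e, f]"]) (simp_all add: new)
  have V: "br D [(e, b), (d, f), (a, e), (c, f)] = br D [(a, b), (c, d)]"
    by (rule br_reduces[where es = "[e, f]"]) (simp_all add: new)
  have joints: "br D [(c, d), (a, b)] = br D [(a, b), (c, d)]"
    by (rule br_set) auto
  show ?thesis
  proof (cases k)
    case Over
    then show ?thesis
      using skein_R2[OF A_power_inverse(1) circle_value_eq(1), of ?X]
      by (simp add: AA AB BA BB joints)
  qed (use assms V joints in simp_all)
qed

text \<open>In the fact names \<open>L\<close> and \<open>R\<close> tell the side. The next letter
  is the splice of the \<open>k'\<close> crossing, named as for \<open>Over\<close>; then come those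
  of the first and second \<open>k\<close> crossing, or one \<open>V\<close> if these are virtual.
  For virtual \<open>k\<close> the sides agree state by state.\<close>

lemma br_R3:
  assumes "k \<noteq> Under" "\<not> (k = Over \<and> k' = Virtual)" "distinct [e1, e2, e3]"
    and "{e1, e2, e3} \<inter> ({p1, p2, p3, p4, p5, p6} \<union> labels D) = {}"
  shows "br (Crossing k p1 p2 e1 e2 # Crossing k e1 p3 p4 e3 # Crossing k' e2 e3 p5 p6 # D) []
    = br (Crossing k e1 e2 p4 p5 # Crossing k p1 e3 e1 p6 # Crossing k' p2 p3 e2 e3 # D) []"
proof -
  have new: "e1 \<noteq> e2" "e1 \<noteq> e3" "e2 \<noteq> e3" "e2 \<noteq> e1" "e3 \<noteq> e1" "e3 \<noteq> e2"
      "e1 \<notin> labels D" "e2 \<notin> labels D" "e3 \<notin> labels D"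
      "e1 \<noteq> p1" "e1 \<noteq> p2" "e1 \<noteq> p3" "e1 \<noteq> p4" "e1 \<noteq> p5" "e1 \<noteq> p6"
      "p1 \<noteq> e1" "p2 \<noteq> e1" "p3 \<noteq> e1" "p4 \<noteq> e1" "p5 \<noteq> e1" "p6 \<noteq> e1"
      "e2 \<noteq> p1" "e2 \<noteq> p2" "e2 \<noteq> p3" "e2 \<noteq> p4" "e2 \<noteq> p5" "e2 \<noteq> p6"
      "p1 \<noteq> e2" "p2 \<noteq> e2" "p3 \<noteq> e2" "p4 \<noteq> e2" "p5 \<noteq> e2" "p6 \<noteq> e2"
      "e3 \<noteq> p1" "e3 \<noteq> p2" "e3 \<noteq> p3" "e3 \<noteq> p4" "e3 \<noteq> p5" "e3 \<noteq> p6"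
      "p1 \<noteq> e3" "p2 \<noteq> e3" "p3 \<noteq> e3" "p4 \<noteq> e3" "p5 \<noteq> e3" "p6 \<noteq> e3"
    using assms(3,4) by auto
  note red = br_reduces[where es = "[e1, e2, e3]"]
  note redc = br_reduces_circle[where es = "[e1, e2]" and e = e3]
  have LAV: "br D [(e3, p5), (p6, e2), (e1, p4), (p3, e3), (p1, e1), (p2, e2)]
      = br D [(p1, p4), (p2, p6), (p3, p5)]"
    by (rule red) (simp_all add: new)
  have RAV: "br D [(p3, e2), (e3, p2), (p1, e1), (e3, p6), (e1, p4), (e2, p5)]
      = br D [(p1, p4), (p2, p6), (p3, p5)]"
    by (rule red) (simp_all add: new)
  have LBV: "br D [(e2, e3), (p5, p6), (e1, p4), (p3, e3), (p1, e1), (p2, e2)]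
      = br D [(p1, p4), (p2, p3), (p5, p6)]"
    by (rule red) (simp_all add: new)
  have RBV: "br D [(p2, p3), (e2, e3), (p1, e1), (e3, p6), (e1, p4), (e2, p5)]
      = br D [(p1, p4), (p2, p3), (p5, p6)]"
    by (rule red) (simp_all add: new)
  have LVV: "br D [(e2, p5), (e3, p6), (e1, p4), (p3, e3), (p1, e1), (p2, e2)]
      = br D [(p1, p4), (p2, p5), (p3, p6)]"
    by (rule red) (simp_all add: new)
  have RVV: "br D [(p2, e2), (p3, e3), (p1, e1), (e3, p6), (e1, p4), (e2, p5)]
      = br D [(p1, p4), (p2, p5), (p3, p6)]"
    by (rule red) (simp_all add: new)

  have LBAA: "br D [(e2, e3), (p5, p6), (p3, p4), (e3, e1), (p2, e1), (e2, p1)]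
      = br D [(p1, p2), (p3, p4), (p5, p6)]"
    by (rule red) (simp_all add: new)
  have LBAB: "br D [(e2, e3), (p5, p6), (e1, p3), (p4, e3), (p2, e1), (e2, p1)]
      = br D [(p2, p3), (p1, p4), (p5, p6)]"
    by (rule red) (simp_all add: new)
  \<comment> \<open>The inner labels close up to a triangle, which shrinks to the loop at
    \<open>e3\<close>.\<close>
  have LBBA: "br D [(e2, e3), (p5, p6), (p3, p4), (e3, e1), (p1, p2), (e1, e2)]
      = circle_value * br D [(p1, p2), (p3, p4), (p5, p6)]"
    by (rule redc) (simp_all add: new)
  have LBBB: "br D [(e2, e3), (p5, p6), (e1, p3), (p4, e3), (p1, p2), (e1, e2)]
      = br D [(p1, p2), (p3, p4), (p5, p6)]"
    by (rule red) (simp_all add: new)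
  have RBAA: "br D [(p2, p3), (e2, e3), (e3, e1), (p6, p1), (e2, p4), (p5, e1)]
      = br D [(p1, p6), (p2, p3), (p4, p5)]"
    by (rule red) (simp_all add: new)
  have RBAB: "br D [(p2, p3), (e2, e3), (p1, e3), (e1, p6), (e2, p4), (p5, e1)]
      = br D [(p2, p3), (p1, p4), (p5, p6)]"
    by (rule red) (simp_all add: new)
  have RBBA: "br D [(p2, p3), (e2, e3), (e3, e1), (p6, p1), (e1, e2), (p4, p5)]
      = circle_value * br D [(p1, p6), (p2, p3), (p4, p5)]"
    by (rule redc) (simp_all add: new)
  have RBBB: "br D [(p2, p3), (e2, e3), (p1, e3), (e1, p6), (e1, e2), (p4, p5)]
      = br D [(p1, p6), (p2, p3), (p4, p5)]"
    by (rule red) (simp_all add: new)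

  have LAAA: "br D [(e3, p5), (p6, e2), (p3, p4), (e3, e1), (p2, e1), (e2, p1)]
      = br D [(p1, p6), (p2, p5), (p3, p4)]"
    by (rule red) (simp_all add: new)
  have LAAB: "br D [(e3, p5), (p6, e2), (e1, p3), (p4, e3), (p2, e1), (e2, p1)]
      = br D [(p1, p6), (p2, p3), (p4, p5)]"
    by (rule red) (simp_all add: new)
  have LABA: "br D [(e3, p5), (p6, e2), (p3, p4), (e3, e1), (p1, p2), (e1, e2)]
      = br D [(p1, p2), (p3, p4), (p5, p6)]"
    by (rule red) (simp_all add: new)
  have LABB: "br D [(e3, p5), (p6, e2), (e1, p3), (p4, e3), (p1, p2), (e1, e2)]
      = br D [(p1, p2), (p3, p6), (p4, p5)]"
    by (rule red) (simp_all add: new)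
  have RAAA: "br D [(p3, e2), (e3, p2), (e3, e1), (p6, p1), (e2, p4), (p5, e1)]
      = br D [(p1, p6), (p2, p5), (p3, p4)]"
    by (rule red) (simp_all add: new)
  have RAAB: "br D [(p3, e2), (e3, p2), (p1, e3), (e1, p6), (e2, p4), (p5, e1)]
      = br D [(p1, p2), (p3, p4), (p5, p6)]"
    by (rule red) (simp_all add: new)
  have RABA: "br D [(p3, e2), (e3, p2), (e3, e1), (p6, p1), (e1, e2), (p4, p5)]
      = br D [(p1, p6), (p2, p3), (p4, p5)]"
    by (rule red) (simp_all add: new)
  have RABB: "br D [(p3, e2), (e3, p2), (p1, e3), (e1, p6), (e1, e2), (p4, p5)]
      = br D [(p1, p2), (p3, p6), (p4, p5)]"
    by (rule red) (simp_all add: new)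
  note L = LAAA LAAB LABA LABB LBAA LBAB LBBA LBBB LAV LBV LVV
  note R = RAAA RAAB RABA RABB RBAA RBAB RBBA RBBB RAV RBV RVV
  show ?thesis
  proof (cases k)
    case Over
    then have "k' = Over \<or> k' = Under" using assms by (cases k') auto
    then show ?thesis
      using Over skein_R3[OF A_power_inverse(1) circle_value_eq(1)]
      by (elim disjE) (simp_all add: L R)
  next
    case Virtual
    then show ?thesis by (cases k') (simp_all add: L R)
  qed (use assms in simp)
qed

text \<open>With comparisons as numbers, the demand that a label occur twice becomes a linear
  equation.\<close>

lemma count_list_Cons: "count_list (x # xs) y = of_bool (x = y) + count_list xs y"
  by simp

lemma count_labels_eq_0:
  "count_list (concat (map ends D)) e = 0 \<longleftrightarrow> e \<notin> labels D"
proof -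
  have "set (ends n) = edges n" for n :: "nat node" by (cases n) simp_all
  then show ?thesis by (simp add: count_list_0_iff labels_def)
qed

text \<open>An inner label of a tangle has both its occurrences there, which supplies the freshness
  that the replacement lemmas require.\<close>

lemma bracket_move:
  assumes "move D E" "virtual_link_diagram D" "virtual_link_diagram E"
  shows "unit_multiple (br D []) (br E [])"
proof -
  have count: "count_list (concat (map ends D)) e = 2" if "e \<in> labels D" "virtual_link_diagram D"
    for e D using that by (auto simp: virtual_link_diagram_def)
  show ?thesis
    using assms
  proof (induction rule: move.induct)
    case (reorder D E)
    then show ?case using br_mset[OF reorder.hyps] by (simp add: unit_multiple_refl)
  next
    case (rename f D)
    then show ?case using br_rename[of f D "[]"] by (simp add: unit_multiple_refl)
  next
    case (turn_crossing k a b c d D)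
    have "br D [(b, d), (c, a)] = br D [(a, c), (b, d)]"
      by (rule br_symcl) auto
    moreover have "br D [(c, d), (a, b)] = br D [(a, b), (c, d)]"
      by (rule br_set) auto
    ultimately show ?case by (cases k) (simp_all add: unit_multiple_refl)
  next
    case (turn_joint a b D)
    have "br D [(b, a)] = br D [(a, b)]"
      by (rule br_symcl) auto
    then show ?case by (simp add: unit_multiple_refl)
  next
    case (remove_joint a b D)
    \<comment> \<open>As \<open>a\<close> and \<open>b\<close> differ, the joint contains only one
      of the two occurrences of \<open>a\<close>; the other lies in \<open>D\<close>, so contraction
      loses no curve.\<close>
    have "a \<in> labels D"
      using count[OF _ remove_joint.prems(1), of a] remove_joint.hyps
        count_labels_eq_0[of D a] by auto
    then show ?case
      using br_contract[of a b D "[]"] remove_joint.hyps by (simp add: unit_multiple_refl)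
  next
    case (R1 a b D k c)
    show ?case
      by (rule br_R1)
        (use count[OF _ R1.prems(2), of c] in
          \<open>auto simp: count_list_Cons simp flip: count_labels_eq_0 simp del: count_list.simps(2)\<close>)
  next
    case (R2 k a b c d D e f)
    have "e \<noteq> f \<and> {e, f} \<inter> ({a, b, c, d} \<union> labels D) = {}"
      using count[OF _ R2.prems(2), of e] count[OF _ R2.prems(2), of f]
      by (auto simp: count_list_Cons simp flip: count_labels_eq_0 simp del: count_list.simps(2))
    then show ?case
      using br_R2[of k e f a b c d D] R2.hyps by (simp only: unit_multiple_refl simp_thms)
  next
    case (R3 k k' p1 p2 e1 e2 p3 p4 e3 p5 p6 D)
    have "distinct [e1, e2, e3] \<and> {e1, e2, e3} \<inter> ({p1, p2, p3, p4, p5, p6} \<union> labels D) = {}"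
      using count[OF _ R3.prems(1), of e1] count[OF _ R3.prems(1), of e2] count[OF _ R3.prems(1), of e3]
      by (auto simp: count_list_Cons simp flip: count_labels_eq_0 simp del: count_list.simps(2))
    then show ?case
      using br_R3[of k k' e1 e2 e3 p1 p2 p3 p4 p5 p6 D] R3.hyps
      by (simp only: unit_multiple_refl simp_thms)
  qed
qed

section \<open>Units and the span\<close>

lemma lookup_single_times:
  fixes f :: laurent_poly
  shows "Poly_Mapping.lookup (Poly_Mapping.single m c * f) k = c * Poly_Mapping.lookup f (k - m)"
proof -
  have "k = l + q \<longleftrightarrow> q = k - l" for l q :: int by auto
  then have "Poly_Mapping.lookup (Poly_Mapping.single m c * f) k
      = (\<Sum>l. (c when m = l) * Poly_Mapping.lookup f (k - l))"
    by (simp add: lookup_mult lookup_single)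
  also have "\<dots> = c * Poly_Mapping.lookup f (k - m)"
    by (simp add: when_mult)
  finally show ?thesis .
qed

lemma span_unit_multiple:
  assumes "unit_multiple f g"
  shows "span g = span f"
proof -
  obtain m c where c: "c = 1 \<or> c = - 1" and g: "g = Poly_Mapping.single m c * f"
    using assms by (auto simp: unit_multiple_def)
  have "Poly_Mapping.lookup g k = c * Poly_Mapping.lookup f (k - m)" for k
    by (simp add: g lookup_single_times)
  then have "k \<in> Poly_Mapping.keys g \<longleftrightarrow> k - m \<in> Poly_Mapping.keys f" for k
    using c by (auto simp: in_keys_iff)
  then have keys: "Poly_Mapping.keys g = (+) m ` Poly_Mapping.keys f"
    by (force simp: image_iff)
  show ?thesis
  proof (cases "Poly_Mapping.keys f = {}")
    \<comment> \<open>For the zero polynomial both spans are the same unspecified value.\<close>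
    case True
    then show ?thesis by (simp add: span_def keys)
  next
    case False
    have "mono ((+) m)" by (simp add: mono_def)
    then have "Max (Poly_Mapping.keys g) = m + Max (Poly_Mapping.keys f)"
      "Min (Poly_Mapping.keys g) = m + Min (Poly_Mapping.keys f)"
      using False by (simp_all add: keys mono_Max_commute mono_Min_commute)
    then show ?thesis by (simp add: span_def)
  qed
qed

section \<open>The recursion agrees with the state sum\<close>

definition strand_pairs :: "diagram \<Rightarrow> (nat \<Rightarrow> splice_type) \<Rightarrow> (nat \<times> nat) list" where
  "strand_pairs D s = concat (map (\<lambda>i. smooth (s i) (D ! i)) [0..<length D])"

lemma labels_splice_node: "labels (splice_node t n) = edges n"
  by (cases "(t, n)" rule: splice_node.cases) (auto simp: labels_def)

lemma strands_splice_node: "(\<Union>n'\<in>set (splice_node t n). strands n') = set (smooth t n)"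
  by (cases "(t, n)" rule: smooth.cases) auto

lemma labels_eq_Union: "labels D = (\<Union>i<length D. edges (D ! i))"
  by (force simp: labels_def in_set_conv_nth)

lemma labels_spliced: "labels (spliced D s) = labels D"
proof -
  have "labels (spliced D s) = (\<Union>i<length D. labels (splice_node (s i) (D ! i)))"
    by (force simp: spliced_def labels_def)
  then show ?thesis by (simp add: labels_splice_node labels_eq_Union[of D])
qed

lemma verts_strand_pairs: "verts (strand_pairs D s) = labels D"
proof -
  have "verts (strand_pairs D s) = (\<Union>i<length D. verts (smooth (s i) (D ! i)))"
    by (force simp: strand_pairs_def verts_def)
  then show ?thesis by (simp add: verts_smooth labels_eq_Union[of D])
qed

lemma strands_spliced: "(\<Union>n\<in>set (spliced D s). strands n) = set (strand_pairs D s)"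
  by (auto simp: spliced_def strand_pairs_def strands_splice_node[symmetric])

lemma components_spliced:
  "components (spliced D s) = conn_classes (labels D) (set (strand_pairs D s))"
  by (simp add: components_def labels_spliced strands_spliced)

lemma card_components_spliced: "card (components (spliced D s)) = ncomp (strand_pairs D s)"
  by (simp add: components_spliced ncomp_def verts_strand_pairs)

lemma real_crossings_snoc:
  "real_crossings (D @ [n]) = (if is_real n then insert (length D) (real_crossings D) else real_crossings D)"
  by (auto simp: real_crossings_def nth_append less_Suc_eq)

lemma finite_real_crossings [simp]: "finite (real_crossings D)"
  by (simp add: real_crossings_def)

lemma splice_type_UNIV: "(UNIV :: splice_type set) = {ASplice, BSplice}"
  using splice_type.exhaust by blast

lemma finite_states: "finite (states D)"
  by (simp add: states_def finite_PiE splice_type_UNIV)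

definition weight :: "diagram \<Rightarrow> (nat \<Rightarrow> splice_type) \<Rightarrow> int" where
  "weight D s = int (splice_count D s ASplice) - int (splice_count D s BSplice)"

lemma strand_pairs_snoc: "strand_pairs (D @ [n]) s = strand_pairs D s @ smooth (s (length D)) n"
  by (auto simp: strand_pairs_def nth_append intro!: arg_cong[of _ _ concat])

lemma strand_pairs_upd: "strand_pairs D (s(length D := t)) = strand_pairs D s"
  unfolding strand_pairs_def by (rule arg_cong[of _ _ concat]) auto

lemma weight_eq_sum: "weight D s = (\<Sum>p\<in>real_crossings D. if s p = ASplice then 1 else - 1)"
proof -
  have "s p \<noteq> ASplice \<longleftrightarrow> s p = BSplice" for p by (cases "s p") auto
  then show ?thesis
    by (simp add: weight_def splice_count_def sum.If_cases Int_def)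
qed

lemma weight_snoc:
  "is_real n \<Longrightarrow> weight (D @ [n]) (s(length D := t)) = weight D s + (if t = ASplice then 1 else - 1)"
proof -
  assume "is_real n"
  have "length D \<notin> real_crossings D" by (simp add: real_crossings_def)
  then have "(\<Sum>p\<in>real_crossings D. if (s(length D := t)) p = ASplice then 1 else - 1 :: int)
      = (\<Sum>p\<in>real_crossings D. if s p = ASplice then 1 else - 1)"
    by (intro sum.cong) auto
  with \<open>is_real n\<close> \<open>length D \<notin> real_crossings D\<close> show ?thesis
    by (simp add: weight_eq_sum real_crossings_snoc del: fun_upd_apply) simp
qed

lemma smooth_not_real: "\<not> is_real n \<Longrightarrow> smooth t n = smooth t' n"
  by (cases "(t, n)" rule: smooth.cases; cases t') auto

text \<open>States refer to positions, so the resolved prefix \<open>D\<close> grows at its end: a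
  new crossing gets position \<open>length D\<close> and leaves the earlier ones alone. The suffix
  \<open>E\<close> is general because \<open>br\<close> consumes its list from the front.\<close>

lemma br_eq_sum:
  "br (D @ E) [] = (\<Sum>s\<in>states D. A_power (weight D s) * br E (strand_pairs D s))"
proof (induction D arbitrary: E rule: rev_induct)
  case Nil
  show ?case
    by (simp add: states_def real_crossings_def weight_def splice_count_def strand_pairs_def)
next
  case (snoc n D)
  have perm: "br E (smooth t n @ strand_pairs D s) = br E (strand_pairs D s @ smooth t n)" for s t
    by (rule br_set) auto
  have IH: "br ((D @ [n]) @ E) [] = (\<Sum>s\<in>states D. A_power (weight D s) * br (n # E) (strand_pairs D s))"
    using snoc.IH[of "n # E"] by simp
  show ?case
  proof (cases "is_real n")
    case False
    then have "states (D @ [n]) = states D" "weight (D @ [n]) s = weight D s" for s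
      by (simp_all add: states_def real_crossings_snoc weight_eq_sum)
    moreover have "smooth ASplice n = smooth (s (length D)) n" for s
      using False by (rule smooth_not_real)
    ultimately show ?thesis
      unfolding IH using False by (simp add: strand_pairs_snoc perm)
  next
    case True
    have notin: "length D \<notin> real_crossings D" by (simp add: real_crossings_def)
    define h where "h s = A_power (weight (D @ [n]) s) * br E (strand_pairs (D @ [n]) s)" for s
    \<comment> \<open>A state of \<open>D @ [n]\<close> is a state of \<open>D\<close> together with
      a splice at the new position.\<close>
    have "(\<Sum>s\<in>states (D @ [n]). h s)
        = (\<Sum>(t, s)\<in>UNIV \<times> states D. h (s(length D := t)))"
    proof -
      have "states (D @ [n]) = (\<lambda>(t, s). s(length D := t)) ` (UNIV \<times> states D)"
        using True unfolding states_def real_crossings_snoc by (simp add: PiE_insert_eq)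
      moreover have "inj_on (\<lambda>(t, s). s(length D := t)) (UNIV \<times> states D)"
        unfolding states_def by (rule inj_combinator[OF notin])
      ultimately show ?thesis by (simp add: sum.reindex case_prod_unfold o_def)
    qed
    also have "\<dots> = (\<Sum>s\<in>states D. h (s(length D := ASplice)) + h (s(length D := BSplice)))"
      by (subst sum.cartesian_product[symmetric]) (simp add: splice_type_UNIV sum.distrib)
    also have "\<dots> = (\<Sum>s\<in>states D. A_power (weight D s) * br (n # E) (strand_pairs D s))"
    proof -
      have split: "A_power (w + 1) = A_power w * A_power 1" "A_power (w - 1) = A_power w * A_power (- 1)"
        for w by (simp_all add: A_power_mult)
      show ?thesis
        using True by (intro sum.cong)
          (simp_all add: h_def weight_snoc strand_pairs_snoc strand_pairs_upd perm split
            distrib_left mult.assoc)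
    qed
    finally show ?thesis unfolding h_def by (simp only: IH)
  qed
qed

lemma bracket_eq_br: "bracket D = br D []"
proof -
  have "bracket D = (\<Sum>s\<in>states D. A_power (weight D s) * br [] (strand_pairs D s))"
    by (simp add: bracket_def state_bracket_def card_components_spliced weight_def circle_value_def)
  then show ?thesis using br_eq_sum[of D "[]"] by simp
qed

lemma span_bracket_equivalent:
  assumes "equivalent_diagrams D E"
  shows "span (bracket D) = span (bracket E)"
  using assms unfolding equivalent_diagrams_def
proof (induction rule: equivclp_induct)
  case (step E F)
  then show ?case
    using span_unit_multiple[OF bracket_move] by (metis bracket_eq_br)
qed simp

text \<open>All members of the class are equivalent to one representative, so the definite
  description has a unique value.\<close>

lemma link_span_eq:
  assumes "L \<in> virtual_links" "D \<in> L"
  shows "link_span L = span (bracket D)"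
proof -
  obtain K where K: "\<And>E. E \<in> L \<Longrightarrow> equivalent_diagrams K E"
    using assms(1) unfolding virtual_links_def quotient_def by blast
  have "\<forall>E\<in>L. span (bracket E) = span (bracket D)"
    using span_bracket_equivalent[OF K] assms(2) by metis
  then show ?thesis
    unfolding link_span_def using assms(2) by (intro the_equality) metis+
qed

section \<open>The span of a pseudo-adequate diagram\<close>

text \<open>An extreme term arises only by choosing the same summand in every factor. Both ends are
  recorded, one for each splice type.\<close>

lemma lookup_circle_value_power:
  "(\<bar>k\<bar> > 2 * int n \<longrightarrow> Poly_Mapping.lookup (circle_value ^ n) k = 0) \<and>
   Poly_Mapping.lookup (circle_value ^ n) (2 * int n) = (- 1) ^ n \<and>
   Poly_Mapping.lookup (circle_value ^ n) (- 2 * int n) = (- 1) ^ n"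
proof (induction n arbitrary: k)
  case 0
  show ?case by (simp add: lookup_one when_def)
next
  case (Suc n)
  have rec: "Poly_Mapping.lookup (circle_value ^ Suc n) k
      = - Poly_Mapping.lookup (circle_value ^ n) (k - 2) - Poly_Mapping.lookup (circle_value ^ n) (k + 2)"
    for k
    by (simp add: circle_value_def A_power_def left_diff_distrib lookup_minus lookup_single_times
        flip: single_uminus)
  show ?case
  proof (intro conjI impI)
    assume "\<bar>k\<bar> > 2 * int (Suc n)"
    then show "Poly_Mapping.lookup (circle_value ^ Suc n) k = 0"
      unfolding rec using Suc.IH[of "k - 2"] Suc.IH[of "k + 2"] by auto
  next
    \<comment> \<open>The other shifted coefficient lies beyond the previous bound and
      vanishes.\<close>
    have "2 * int (Suc n) - 2 = 2 * int n" by simp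
    then show "Poly_Mapping.lookup (circle_value ^ Suc n) (2 * int (Suc n)) = (- 1) ^ Suc n"
      unfolding rec using Suc.IH[of "2 * int (Suc n) + 2"] by simp
  next
    have "- 2 * int (Suc n) + 2 = - 2 * int n" by simp
    then show "Poly_Mapping.lookup (circle_value ^ Suc n) (- 2 * int (Suc n)) = (- 1) ^ Suc n"
      unfolding rec using Suc.IH[of "- 2 * int (Suc n) - 2"] by simp
  qed
qed

section \<open>Extreme degrees of the contributions of states\<close>

fun other_splice :: "splice_type \<Rightarrow> splice_type" where
  "other_splice ASplice = BSplice"
| "other_splice BSplice = ASplice"

text \<open>Handles both ends of the bracket at once: exponents count powers of A for the A-splice
  and of its inverse for the B-splice.\<close>

fun splice_sign :: "splice_type \<Rightarrow> int" where
  "splice_sign ASplice = 1"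
| "splice_sign BSplice = - 1"

text \<open>The largest exponent of \<open>A\<close> (for \<open>t = ASplice\<close>) or of its inverse (for \<open>t = BSplice\<close>)
  in the contribution of the state \<open>s\<close>.\<close>

definition top_degree :: "diagram \<Rightarrow> splice_type \<Rightarrow> (nat \<Rightarrow> splice_type) \<Rightarrow> int" where
  "top_degree D t s = splice_sign t * weight D s + 2 * int (ncomp (strand_pairs D s) - 1)"

lemma lookup_state:
  fixes D s
  defines "f \<equiv> A_power (weight D s) * circle_value ^ (ncomp (strand_pairs D s) - 1)"
  shows "k > top_degree D t s \<Longrightarrow> Poly_Mapping.lookup f (splice_sign t * k) = 0"
    and "Poly_Mapping.lookup f (splice_sign t * top_degree D t s) \<noteq> 0"
proof -
  let ?n = "ncomp (strand_pairs D s) - 1"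
  have f: "Poly_Mapping.lookup f k = Poly_Mapping.lookup (circle_value ^ ?n) (k - weight D s)" for k
    by (simp add: f_def A_power_def lookup_single_times)
  show "Poly_Mapping.lookup f (splice_sign t * k) = 0" if "k > top_degree D t s"
    using that lookup_circle_value_power[of ?n "splice_sign t * k - weight D s"]
    by (cases t) (auto simp: f top_degree_def)
  show "Poly_Mapping.lookup f (splice_sign t * top_degree D t s) \<noteq> 0"
    using lookup_circle_value_power[of ?n 0]
    by (cases t) (auto simp: f top_degree_def)
qed

lemma splice_count_sum:
  "splice_count D s t + splice_count D s (other_splice t) = crossing_number D"
proof -
  have "s p = t \<or> s p = other_splice t" for p by (cases "s p"; cases t) auto
  then have "real_crossings D
      = {p \<in> real_crossings D. s p = t} \<union> {p \<in> real_crossings D. s p = other_splice t}"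
    by auto
  moreover have "{p \<in> real_crossings D. s p = t} \<inter> {p \<in> real_crossings D. s p = other_splice t} = {}"
    by (cases t) auto
  ultimately show ?thesis
    unfolding splice_count_def crossing_number_def
    by (metis (no_types, lifting) card_Un_disjoint finite_Un finite_real_crossings)
qed

lemma weight_via_count:
  "splice_sign t * weight D s = int (crossing_number D) - 2 * int (splice_count D s (other_splice t))"
  using splice_count_sum[of D s t] by (cases t) (auto simp: weight_def)

text \<open>The two smoothings are the two pairs of opposite sides of the quadrilateral on the four
  ends; all other strands form the fixed graph \<open>R\<close>.\<close>

lemma ncomp_switch:
  assumes "p \<in> real_crossings D"
  shows "ncomp (strand_pairs D s) \<le> Suc (ncomp (strand_pairs D (s(p := t))))"
proof -
  define R where "R = (\<Union>i\<in>{..<length D} - {p}. set (smooth (s i) (D ! i)))"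
  have p: "p < length D" "is_real (D ! p)" using assms by (auto simp: real_crossings_def)
  then have set: "set (strand_pairs D (s(p := u))) = set (smooth u (D ! p)) \<union> R" for u
  proof -
    have "{..<length D} = insert p ({..<length D} - {p})" using p(1) by auto
    then have "set (strand_pairs D (s(p := u)))
        = (\<Union>i\<in>insert p ({..<length D} - {p}). set (smooth ((s(p := u)) i) (D ! i)))"
      by (simp add: strand_pairs_def atLeast0LessThan)
    then show ?thesis unfolding UN_insert R_def by simp
  qed
  obtain k a b c d where node: "D ! p = Crossing k a b c d" and k: "k \<noteq> Virtual"
    using p(2) by (cases "D ! p") auto
  have V: "finite (labels D)" "a \<in> labels D" "b \<in> labels D" "c \<in> labels D" "d \<in> labels D"
    using p(1) node by (force simp: labels_eq_Union)+
  have pairs: "set (smooth u (D ! p)) = {(a, b), (c, d)} \<or> set (smooth u (D ! p)) = {(b, c), (d, a)}"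
    for u using node k by (cases k; cases u) auto
  \<comment> \<open>For the quadrilateral lemma with cyclically shifted ends, which exchanges the
    two smoothings.\<close>
  have "{(d, a), (b, c)} = {(b, c), (d, a)}" "{(c, d), (a, b)} = {(a, b), (c, d)}" by auto
  then have "card (conn_classes (labels D) (set (smooth u (D ! p)) \<union> R))
      \<le> Suc (card (conn_classes (labels D) (set (smooth t (D ! p)) \<union> R)))" for u
    using pairs[of u] pairs[of t]
      card_conn_classes_quadrilateral[OF V, of R]
      card_conn_classes_quadrilateral[OF V(1,3,4,5,2), of R]
    by (elim disjE) simp_all
  from this[of "s p"] set[of "s p"] set[of t] show ?thesis
    by (simp add: ncomp_def verts_strand_pairs)
qed

lemma ncomp_strand_pairs_pos: "D \<noteq> [] \<Longrightarrow> ncomp (strand_pairs D s) > 0"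
proof (rule ncomp_pos, rule notI)
  assume "D \<noteq> []" "strand_pairs D s = []"
  moreover have "edges n \<noteq> {}" for n :: "nat node" by (cases n) auto
  ultimately show False
    using verts_strand_pairs[of D s] by (cases D) auto
qed

lemma pseudo_adequateD:
  assumes "pseudo_adequate D" "s \<in> states D" "splice_count D s (other_splice t) = 1"
  shows "ncomp (strand_pairs D s) \<le> ncomp (strand_pairs D (const_state D t))"
  using assms by (cases t) (auto simp: pseudo_adequate_def card_components_spliced)

lemma splice_count_const:
  "splice_count D (const_state D t) (other_splice t) = 0"
  by (cases t) (auto simp: splice_count_def const_state_def)

lemma top_degree_less:
  assumes "pseudo_adequate D" "D \<noteq> []" "s \<in> states D" "s \<noteq> const_state D t"
  shows "top_degree D t s < top_degree D t (const_state D t)"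
proof -
  have "top_degree D t s < top_degree D t (const_state D t)"
    if "splice_count D s (other_splice t) = Suc n" "s \<in> states D" for n s
    using that
  proof (induction n arbitrary: s)
    case 0
    then show ?case
      using pseudo_adequateD[OF assms(1), of s t]
      by (simp add: top_degree_def weight_via_count splice_count_const)
  next
    case (Suc n)
    let ?S = "{p \<in> real_crossings D. s p = other_splice t}"
    have "card ?S = Suc (Suc n)" using Suc.prems by (simp add: splice_count_def)
    then obtain p where p: "p \<in> real_crossings D" "s p = other_splice t"
      by (metis (mono_tags, lifting) card.empty empty_Collect_eq nat.distinct(1))
    let ?s = "s(p := t)"
    have "t \<noteq> other_splice t" by (cases t) auto
    then have "{q \<in> real_crossings D. ?s q = other_splice t} = ?S - {p}" by auto
    then have count: "splice_count D ?s (other_splice t) = Suc n"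
      using \<open>card ?S = Suc (Suc n)\<close> p by (simp add: splice_count_def)
    moreover have "?s \<in> states D"
      using Suc.prems(2) p by (auto simp: states_def)
    ultimately have "top_degree D t ?s < top_degree D t (const_state D t)"
      by (rule Suc.IH)
    \<comment> \<open>Undoing the switch gains 2 in weight and loses at most one curve, worth 2.
      Positivity of the curve counts keeps the truncated \<open>- 1\<close> exact.\<close>
    moreover have "top_degree D t s \<le> top_degree D t ?s"
      using ncomp_switch[OF p(1), of s t] ncomp_strand_pairs_pos[OF assms(2)] count Suc.prems(1)
      by (simp add: top_degree_def weight_via_count)
    ultimately show ?case by simp
  qed
  moreover have "splice_count D s (other_splice t) \<noteq> 0"
  proof
    assume "splice_count D s (other_splice t) = 0"
    then have "\<And>p. p \<in> real_crossings D \<Longrightarrow> s p \<noteq> other_splice t"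
      by (auto simp: splice_count_def)
    moreover have "u \<noteq> other_splice t \<Longrightarrow> u = t" for u by (cases u; cases t) auto
    ultimately have "s = const_state D t"
      using assms(3) by (auto simp: states_def const_state_def fun_eq_iff PiE_def extensional_def)
    with assms(4) show False by simp
  qed
  ultimately show ?thesis
    using assms(3) by (metis not0_implies_Suc)
qed

lemma lookup_bracket:
  "Poly_Mapping.lookup (bracket D) k = (\<Sum>s\<in>states D. Poly_Mapping.lookup
     (A_power (weight D s) * circle_value ^ (ncomp (strand_pairs D s) - 1)) k)"
  using br_eq_sum[of D "[]"] by (simp add: bracket_eq_br lookup_sum)

lemma bracket_extreme:
  fixes D t
  defines "m \<equiv> top_degree D t (const_state D t)"
  assumes "pseudo_adequate D" "D \<noteq> []"
  shows "k > m \<Longrightarrow> Poly_Mapping.lookup (bracket D) (splice_sign t * k) = 0"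
    and "Poly_Mapping.lookup (bracket D) (splice_sign t * m) \<noteq> 0"
proof -
  have less: "top_degree D t s < m" if "s \<in> states D" "s \<noteq> const_state D t" for s
    unfolding m_def using assms that by (intro top_degree_less)
  then have "top_degree D t s \<le> m" if "s \<in> states D" for s
    using that by (cases "s = const_state D t") (auto simp: m_def intro: less_imp_le)
  then show "Poly_Mapping.lookup (bracket D) (splice_sign t * k) = 0" if "k > m"
    unfolding lookup_bracket
    using that by (intro sum.neutral ballI lookup_state(1)) (meson le_less_trans)
  have "const_state D t \<in> states D" by (simp add: const_state_def states_def)
  moreover have "(\<Sum>s\<in>states D - {const_state D t}. Poly_Mapping.lookup
     (A_power (weight D s) * circle_value ^ (ncomp (strand_pairs D s) - 1)) (splice_sign t * m)) = 0"
    using less by (intro sum.neutral ballI lookup_state(1)) auto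
  ultimately have "Poly_Mapping.lookup (bracket D) (splice_sign t * m) = Poly_Mapping.lookup
      (A_power (weight D (const_state D t)) * circle_value ^ (ncomp (strand_pairs D (const_state D t)) - 1))
      (splice_sign t * m)"
    unfolding lookup_bracket by (subst sum.remove[OF finite_states]) auto
  then show "Poly_Mapping.lookup (bracket D) (splice_sign t * m) \<noteq> 0"
    using lookup_state(2)[of D "const_state D t" t] unfolding m_def by simp
qed

text \<open>The lowest exponent is minus the top degree for the B-splice, so the span is the sum of
  both top degrees. Each is c(D) + 2 (n - 1) with \<open>n\<close> curves, whence the -4.\<close>

lemma span_bracket_pseudo_adequate:
  assumes "pseudo_adequate D" "D \<noteq> []"
  shows "span (bracket D) = 2 * int (crossing_number D)
    + 2 * (int (ncomp (strand_pairs D (const_state D ASplice)))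
         + int (ncomp (strand_pairs D (const_state D BSplice)))) - 4"
proof -
  let ?m = "\<lambda>t. top_degree D t (const_state D t)" and ?K = "Poly_Mapping.keys (bracket D)"
  have "k \<le> ?m ASplice" "- ?m BSplice \<le> k" if "k \<in> ?K" for k
    using that bracket_extreme(1)[OF assms, of ASplice k] bracket_extreme(1)[OF assms, of BSplice "- k"]
    by (force simp: in_keys_iff)+
  moreover have "?m ASplice \<in> ?K" "- ?m BSplice \<in> ?K"
    using bracket_extreme(2)[OF assms, of ASplice] bracket_extreme(2)[OF assms, of BSplice]
    by (simp_all add: in_keys_iff)
  ultimately have "Max ?K = ?m ASplice" "Min ?K = - ?m BSplice"
    by (auto intro!: Max_eqI Min_eqI)
  then show ?thesis
    using ncomp_strand_pairs_pos[OF assms(2), of "const_state D ASplice"]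
      ncomp_strand_pairs_pos[OF assms(2), of "const_state D BSplice"]
      weight_via_count[of ASplice D "const_state D ASplice"] splice_count_const[of D ASplice]
      weight_via_count[of BSplice D "const_state D BSplice"] splice_count_const[of D BSplice]
    by (simp add: span_def top_degree_def)
qed

section \<open>The Turaev surface\<close>

lemma real_crossing_node:
  assumes "i \<in> real_crossings D"
  obtains k a b c d where "D ! i = Crossing k a b c d" "k \<noteq> Virtual" "i < length D"
  using assms by (cases "D ! i") (auto simp: real_crossings_def)

lemma real_darts_eq: "real_darts D = real_crossings D \<times> {..<4}"
proof -
  have "length (ends (D ! i)) = 4" if "i \<in> real_crossings D" for i
    using that by (elim real_crossing_node) simp
  then show ?thesis
    by (auto simp: real_darts_def darts_def real_crossings_def)
qed

lemma finite_real_darts [simp]: "finite (real_darts D)"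
  by (simp add: real_darts_eq)

lemma card_real_darts: "card (real_darts D) = 4 * crossing_number D"
  by (simp add: real_darts_eq crossing_number_def card_cartesian_product)

lemma ccw_real:
  assumes "i \<in> real_crossings D"
  shows "ccw D (i, k) = (i, Suc k mod 4)"
  using assms by (elim real_crossing_node) (simp add: ccw_def)

lemma ccw_real_darts: "h \<in> real_darts D \<Longrightarrow> ccw D h \<in> real_darts D"
  by (cases h) (auto simp: real_darts_eq ccw_real)

lemma label_of_in_labels: "h \<in> darts D \<Longrightarrow> label_of D h \<in> labels D"
proof -
  have "set (ends n) = edges n" for n :: "nat node" by (cases n) auto
  then show "h \<in> darts D \<Longrightarrow> label_of D h \<in> labels D"
    unfolding labels_eq_Union label_of_def darts_def using nth_mem by fastforce
qed

lemma real_darts_subset: "real_darts D \<subseteq> darts D"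
  by (auto simp: real_darts_def)

text \<open>The four darts at a real crossing form one cycle, so \<open>fst\<close> matches disks
  with real crossings, taken as the classes of a graph without edges.\<close>

lemma card_disks: "card (disks (turaev_band_surface D)) = crossing_number D"
proof -
  let ?E = "{(h, ccw D h) | h. h \<in> real_darts D}"
  have "card (conn_classes (real_darts D) ?E) = card (conn_classes (real_crossings D) {})"
  proof (rule card_conn_classes_transfer[where f = fst])
    show "fst ` real_darts D \<subseteq> real_crossings D" by (auto simp: real_darts_eq)
    show "\<exists>h\<in>real_darts D. (i, fst h) \<in> conn {}" if "i \<in> real_crossings D" for i
      by (rule bexI[of _ "(i, 0)"]) (use that in \<open>simp_all add: real_darts_eq\<close>)
    fix h h' assume h: "h \<in> real_darts D" "h' \<in> real_darts D"
    show "(h, h') \<in> conn ?E \<longleftrightarrow> (fst h, fst h') \<in> conn {}"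
    proof
      show "(fst h, fst h') \<in> conn {}" if "(h, h') \<in> conn ?E"
        using that by (rule conn_map) (auto simp: ccw_def)
      have from0: "((i, 0), (i, k)) \<in> conn ?E" if "i \<in> real_crossings D" "k < 4" for i k
        using that(2)
      proof (induction k)
        case (Suc k)
        have "(i, k) \<in> real_darts D" "ccw D (i, k) = (i, Suc k)"
          using that(1) Suc.prems by (simp_all add: real_darts_eq ccw_real)
        then have "((i, k), (i, Suc k)) \<in> conn ?E"
          by (intro conn_edge) (metis (mono_tags, lifting) mem_Collect_eq)
        then show ?case using Suc conn_trans by fastforce
      qed simp
      assume "(fst h, fst h') \<in> conn {}"
      then have "fst h = fst h'" by (simp add: conn_def)
      then have "((fst h, 0), h) \<in> conn ?E" "((fst h, 0), h') \<in> conn ?E"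
        using h from0[of "fst h" "snd h"] from0[of "fst h" "snd h'"] by (auto simp: real_darts_eq)
      then show "(h, h') \<in> conn ?E" by (meson conn_sym conn_trans)
    qed
  qed
  then show ?thesis
    by (simp add: disks_def turaev_band_surface_def conn_classes_empty crossing_number_def)
qed

text \<open>The strands that no splice touches: they generate the arcs and are common to
  \<open>D\<close> and all its states.\<close>

definition passing_strands :: "diagram \<Rightarrow> (nat \<times> nat) set" where
  "passing_strands D = (\<Union>n\<in>{n \<in> set D. \<not> is_real n}. strands n)"

lemma strands_subset: "strands n \<subseteq> edges n \<times> edges n"
  by (cases n) auto

lemma passing_strands_subset: "passing_strands D \<subseteq> labels D \<times> labels D"
  using strands_subset unfolding passing_strands_def labels_def by blast

lemma finite_labels [simp]: "finite (labels D)"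
proof -
  have "finite (edges n)" for n :: "nat node" by (cases n) auto
  then show ?thesis by (simp add: labels_def)
qed

lemma arcs_eq: "arcs D = conn_classes (labels D) (passing_strands D)"
  by (simp add: arcs_def passing_strands_def)

text \<open>Sharing an arc means being joined by a walk along passing strands. The walk may be
  empty, as for an edge running directly between real crossings.\<close>

lemma band_pairs_iff:
  "(h, h') \<in> band_pairs D \<longleftrightarrow> h \<in> real_darts D \<and> h' \<in> real_darts D \<and> h \<noteq> h' \<and>
     (label_of D h, label_of D h') \<in> conn (passing_strands D)"
proof -
  have "(\<exists>\<alpha>\<in>arcs D. label_of D h \<in> \<alpha> \<and> label_of D h' \<in> \<alpha>)
      \<longleftrightarrow> (label_of D h, label_of D h') \<in> conn (passing_strands D)"
    if "h \<in> real_darts D" "h' \<in> real_darts D"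
  proof -
    have "label_of D h \<in> labels D" "label_of D h' \<in> labels D"
      using that real_darts_subset label_of_in_labels by blast+
    then show ?thesis
      unfolding arcs_eq using conn_classes_mem_iff conn_class_self
      by (smt (verit, ccfv_SIG))
  qed
  then show ?thesis by (auto simp: band_pairs_def)
qed

subsection \<open>Counting the bands\<close>

lemma card_darts_label:
  "card {h \<in> darts D. label_of D h = e} = count_list (concat (map ends D)) e"
proof -
  have "{h \<in> darts D. label_of D h = e}
      = (SIGMA i:{..<length D}. {k. k < length (ends (D ! i)) \<and> ends (D ! i) ! k = e})"
    by (auto simp: darts_def label_of_def)
  then have "card {h \<in> darts D. label_of D h = e} = (\<Sum>i<length D. count_list (ends (D ! i)) e)"
    by (simp add: count_list_eq_length_filter length_filter_conv_card eq_commute)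
  also have "\<dots> = sum_list (map (\<lambda>n. count_list (ends n) e) D)"
    by (simp add: sum_list_sum_nth atLeast0LessThan)
  also have "\<dots> = count_list (concat (map ends D)) e"
    by (induction D) auto
  finally show ?thesis .
qed

lemma finite_darts: "finite (darts D)"
proof -
  have "darts D = (SIGMA i:{..<length D}. {..<length (ends (D ! i))})"
    by (auto simp: darts_def)
  then show ?thesis by simp
qed

lemma card_darts_labels:
  assumes "virtual_link_diagram D" "\<alpha> \<subseteq> labels D"
  shows "card {h \<in> darts D. label_of D h \<in> \<alpha>} = 2 * card \<alpha>"
proof -
  have "finite \<alpha>" using finite_subset[OF assms(2)] by simp
  have "{h \<in> darts D. label_of D h \<in> \<alpha>} = (\<Union>e\<in>\<alpha>. {h \<in> darts D. label_of D h = e})" by auto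
  also have "card \<dots> = (\<Sum>e\<in>\<alpha>. card {h \<in> darts D. label_of D h = e})"
    using \<open>finite \<alpha>\<close> finite_darts by (intro card_UN_disjoint) auto
  also have "\<dots> = (\<Sum>e\<in>\<alpha>. 2)"
    using assms by (intro sum.cong) (auto simp: card_darts_label virtual_link_diagram_def)
  finally show ?thesis by simp
qed

text \<open>With \<open>m\<close> passing strands in the arc \<open>\<alpha>\<close>, its \<open>2 * card \<alpha>\<close> ends comprise \<open>2 * m\<close> ends of these
  strands and the real darts; connectedness gives \<open>card \<alpha> \<le> m + 1\<close>.\<close>

lemma card_arc_real_darts:
  assumes "virtual_link_diagram D" "\<alpha> \<in> arcs D" "\<alpha> \<inter> label_of D ` real_darts D \<noteq> {}"
  shows "card {h \<in> real_darts D. label_of D h \<in> \<alpha>} = 2"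
proof -
  \<comment> \<open>Half the number of ends is the number of strands: the strand leaving at end
    \<open>k\<close> arrives at end \<open>k + w i\<close>. \<open>P\<close> indexes the passing
    strands by their first ends.\<close>
  define w where "w i = length (ends (D ! i)) div 2" for i
  define P where "P = {(i, k). i < length D \<and> \<not> is_real (D ! i) \<and> k < w i}"
  define opp where "opp h = (fst h, snd h + w (fst h))" for h :: "nat \<times> nat"
  define Q where "Q = {h \<in> P. label_of D h \<in> \<alpha>}"
  let ?R = "{h \<in> real_darts D. label_of D h \<in> \<alpha>}"
  have sub: "\<alpha> \<subseteq> labels D"
    using assms(2) by (auto simp: arcs_eq conn_classes_eq conn_class_def)
  have len: "length (ends n) = 2 * (length (ends n) div 2)" for n :: "nat node" by (cases n) auto
  have strands: "strands n = (\<lambda>k. (ends n ! k, ends n ! (k + length (ends n) div 2)))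
      ` {..<length (ends n) div 2}" for n :: "nat node"
    by (cases n) (simp_all add: lessThan_Suc insert_commute)
  have passing: "passing_strands D = (\<lambda>h. (label_of D h, label_of D (opp h))) ` P"
  proof -
    have "passing_strands D = (\<Union>i\<in>{i. i < length D \<and> \<not> is_real (D ! i)}. strands (D ! i))"
      by (force simp: passing_strands_def in_set_conv_nth)
    also have "\<dots> = (\<Union>i\<in>{i. i < length D \<and> \<not> is_real (D ! i)}.
        (\<lambda>k. (label_of D (i, k), label_of D (opp (i, k)))) ` {..<w i})"
      by (simp add: strands label_of_def opp_def w_def)
    also have "\<dots> = (\<lambda>h. (label_of D h, label_of D (opp h))) ` P"
      by (auto simp: P_def)
    finally show ?thesis .
  qed
  have finP: "finite P"
    using finite_darts[of D] by (rule finite_subset[rotated]) (auto simp: P_def darts_def w_def)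
  have opp_label: "label_of D (opp h) \<in> \<alpha> \<longleftrightarrow> label_of D h \<in> \<alpha>" if "h \<in> P" for h
  proof -
    have c: "(label_of D h, label_of D (opp h)) \<in> conn (passing_strands D)"
      using that by (auto simp: passing intro: conn_edge)
    moreover have "(label_of D h, label_of D (opp h)) \<in> labels D \<times> labels D"
      using that passing passing_strands_subset[of D] by auto
    ultimately show ?thesis
      using c conn_sym[OF c]
        conn_classes_mem_iff[OF assms(2)[unfolded arcs_eq], of "label_of D h" "label_of D (opp h)"]
        conn_classes_mem_iff[OF assms(2)[unfolded arcs_eq], of "label_of D (opp h)" "label_of D h"]
      by auto
  qed
  have darts_iff: "(i, k) \<in> darts D \<longleftrightarrow> i < length D \<and> k < 2 * w i" for i k
    using len[of "D ! i"] by (simp add: darts_def w_def)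
  have darts: "darts D = real_darts D \<union> (P \<union> opp ` P)"
  proof (intro equalityI subsetI)
    fix h assume "h \<in> darts D"
    then obtain i k where h: "h = (i, k)" "i < length D" "k < 2 * w i"
      using darts_iff by (cases h) auto
    show "h \<in> real_darts D \<union> (P \<union> opp ` P)"
    proof (cases "is_real (D ! i)")
      case True
      then show ?thesis
        using \<open>h \<in> darts D\<close> h by (simp add: real_darts_def real_crossings_def)
    next
      case False
      show ?thesis
      proof (cases "k < w i")
        case True
        then show ?thesis using False h by (simp add: P_def)
      next
        case ge: False
        then have "h = opp (i, k - w i)" "(i, k - w i) \<in> P"
          using False h by (auto simp: P_def opp_def)
        then show ?thesis by blast
      qed
    qed
  next
    fix h assume "h \<in> real_darts D \<union> (P \<union> opp ` P)"
    moreover have "P \<subseteq> darts D" "opp ` P \<subseteq> darts D"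
      by (auto simp: P_def opp_def darts_iff)
    ultimately show "h \<in> darts D" using real_darts_subset by blast
  qed
  have "{h \<in> darts D. label_of D h \<in> \<alpha>} = ?R \<union> (Q \<union> opp ` Q)"
    unfolding darts Q_def using opp_label by auto
  also have "card \<dots> = card ?R + card (Q \<union> opp ` Q)"
  proof (rule card_Un_disjoint)
    show "?R \<inter> (Q \<union> opp ` Q) = {}"
      by (auto simp: Q_def P_def opp_def real_darts_def real_crossings_def)
  qed (simp_all add: finP Q_def)
  also have "card (Q \<union> opp ` Q) = card Q + card (opp ` Q)"
  proof (rule card_Un_disjoint)
    show "Q \<inter> opp ` Q = {}" by (auto simp: Q_def P_def opp_def)
  qed (simp_all add: finP Q_def)
  also have "card (opp ` Q) = card Q"
    by (intro card_image inj_onI) (metis add_right_cancel opp_def prod.inject prod_eqI)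
  finally have ends: "2 * card \<alpha> = card ?R + 2 * card Q"
    using card_darts_labels[OF assms(1) sub] by simp
  \<comment> \<open>Several passing strands may carry the same pair of labels, so this is only an
    inequality.\<close>
  have "{e \<in> passing_strands D. fst e \<in> \<alpha>} \<subseteq> (\<lambda>h. (label_of D h, label_of D (opp h))) ` Q"
    by (auto simp: passing Q_def)
  then have "card {e \<in> passing_strands D. fst e \<in> \<alpha>} \<le> card Q"
    using finP by (intro surj_card_le) (auto simp: Q_def)
  moreover have "card \<alpha> \<le> Suc (card {e \<in> passing_strands D. fst e \<in> \<alpha>})"
  proof (rule card_conn_class_le)
    show "\<alpha> \<in> conn_classes (labels D) (passing_strands D)" using assms(2) by (simp add: arcs_eq)
    show "finite (passing_strands D)" using finP by (simp add: passing)
  qed (simp_all add: passing_strands_subset)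
  moreover have "card ?R > 0"
    using assms(3) by (auto simp: card_gt_0_iff)
  \<comment> \<open>By \<open>ends\<close> the number of real darts is even; it is also positive and
    at most 2.\<close>
  ultimately show ?thesis using ends by presburger
qed

text \<open>Bands correspond to the arcs that meet a real crossing, and as pairs they partition the
  4 c(D) real darts.\<close>

lemma card_bands:
  assumes "virtual_link_diagram D"
  shows "card (bands (turaev_band_surface D)) = 2 * crossing_number D"
proof -
  let ?X = "label_of D ` real_darts D"
  let ?R = "\<lambda>\<alpha>. {h \<in> real_darts D. label_of D h \<in> \<alpha>}"
  define B where "B = {{h, h'} | h h'. (h, h') \<in> band_pairs D}"
  have B: "B = ?R ` {\<alpha> \<in> arcs D. \<alpha> \<inter> ?X \<noteq> {}}"
  proof (intro equalityI subsetI)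
    fix b assume "b \<in> B"
    then obtain h h' \<alpha> where b: "b = {h, h'}" "h \<noteq> h'" "h \<in> real_darts D" "h' \<in> real_darts D"
      and \<alpha>: "\<alpha> \<in> arcs D" "label_of D h \<in> \<alpha>" "label_of D h' \<in> \<alpha>"
      by (auto simp: B_def band_pairs_def)
    then have meets: "\<alpha> \<inter> ?X \<noteq> {}" by auto
    have "b = ?R \<alpha>"
      using b \<alpha> card_arc_real_darts[OF assms \<alpha>(1) meets] by (intro card_seteq) auto
    with \<alpha>(1) meets show "b \<in> ?R ` {\<alpha> \<in> arcs D. \<alpha> \<inter> ?X \<noteq> {}}" by blast
  next
    fix b assume "b \<in> ?R ` {\<alpha> \<in> arcs D. \<alpha> \<inter> ?X \<noteq> {}}"
    then obtain \<alpha> where \<alpha>: "\<alpha> \<in> arcs D" "\<alpha> \<inter> ?X \<noteq> {}" "b = ?R \<alpha>" by auto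
    then have "card b = 2" using card_arc_real_darts[OF assms] by simp
    then obtain h h' where "b = {h, h'}" "h \<noteq> h'" by (auto simp: card_2_iff)
    moreover from this \<alpha> have "(h, h') \<in> band_pairs D" by (auto simp: band_pairs_def)
    ultimately show "b \<in> B" unfolding B_def by blast
  qed
  have Union: "\<Union>B = real_darts D"
  proof (intro equalityI subsetI)
    fix h assume h: "h \<in> real_darts D"
    then have "label_of D h \<in> labels D" using real_darts_subset label_of_in_labels by blast
    then obtain \<alpha> where "\<alpha> \<in> arcs D" "label_of D h \<in> \<alpha>"
      using conn_class_self unfolding arcs_eq by metis
    with h show "h \<in> \<Union>B" unfolding B by blast
  qed (auto simp: B)
  have "2 * card B = card (\<Union>B)"
  proof (rule card_partition)
    show "finite B" unfolding B arcs_eq using finite_conn_classes[OF finite_labels] by simp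
    show "finite (\<Union>B)" by (simp add: Union)
    show "card b = 2" if "b \<in> B" for b
      using that card_arc_real_darts[OF assms] unfolding B by auto
    show "b1 \<inter> b2 = {}" if b: "b1 \<in> B" "b2 \<in> B" "b1 \<noteq> b2" for b1 b2
    proof -
      obtain \<alpha> \<beta> where "\<alpha> \<in> arcs D" "\<beta> \<in> arcs D" "b1 = ?R \<alpha>" "b2 = ?R \<beta>"
        using b(1,2) unfolding B by auto
      with b(3) show ?thesis
        using conn_classes_disjoint[of \<alpha> _ _ \<beta>] unfolding arcs_eq by blast
    qed
  qed
  then have "card B = 2 * crossing_number D"
    unfolding Union card_real_darts by simp
  then show ?thesis
    unfolding B_def turaev_band_surface_def by simp
qed

subsection \<open>The boundary\<close>

declare corner_colour.simps [simp del]

fun splice_colour :: "splice_type \<Rightarrow> colour" where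
  "splice_colour ASplice = Red"
| "splice_colour BSplice = Blue"

text \<open>The strands of the splice \<open>t\<close>, kept on darts: labels cannot tell the two
  ends of an edge apart.\<close>

definition corners :: "diagram \<Rightarrow> splice_type \<Rightarrow> ((nat \<times> nat) \<times> (nat \<times> nat)) set" where
  "corners D t = {(h, ccw D h) | h. h \<in> real_darts D \<and> corner_colour D h = splice_colour t}"

definition label_pair :: "diagram \<Rightarrow> (nat \<times> nat) \<times> (nat \<times> nat) \<Rightarrow> nat \<times> nat" where
  "label_pair D = map_prod (label_of D) (label_of D)"

text \<open>Here the colour convention meets the splice convention: the parity of \<open>k\<close>
  selects a pair of opposite corners, and exchanging over with under, or A with B, exchanges the
  pairs.\<close>

lemma set_smooth_real:
  assumes "i \<in> real_crossings D"
  shows "set (smooth t (D ! i)) = (\<lambda>k. (label_of D (i, k), label_of D (ccw D (i, k))))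
    ` {k. k < 4 \<and> corner_colour D (i, k) = splice_colour t}"
proof -
  obtain l a b c d where node: "D ! i = Crossing l a b c d" "l \<noteq> Virtual"
    using assms by (elim real_crossing_node)
  have less4: "k < 4 \<longleftrightarrow> k = 0 \<or> k = 1 \<or> k = 2 \<or> k = 3" for k :: nat by auto
  have parity: "{k :: nat. k < 4 \<and> even k} = {0, 2}" "{k :: nat. k < 4 \<and> odd k} = {1, 3}"
    unfolding less4 by auto
  have "corner_colour D (i, k) = splice_colour t \<longleftrightarrow> (even k \<longleftrightarrow> l = Under \<longleftrightarrow> t = ASplice)" for k
    using node by (cases l; cases t) (auto simp: corner_colour.simps)
  then have indices: "{k. k < 4 \<and> corner_colour D (i, k) = splice_colour t}
      = (if l = Under \<longleftrightarrow> t = ASplice then {0, 2} else {1, 3})"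
    using parity by simp
  have "ccw D (i, 0) = (i, 1)" "ccw D (i, 1) = (i, 2)" "ccw D (i, 2) = (i, 3)" "ccw D (i, 3) = (i, 0)"
    by (simp_all add: ccw_real[OF assms])
  moreover have "label_of D (i, 0) = a" "label_of D (i, 1) = b" "label_of D (i, 2) = c"
    "label_of D (i, 3) = d"
    by (simp_all add: label_of_def node)
  ultimately show ?thesis
    unfolding indices
    using node by (cases l; cases t) (simp_all del: One_nat_def)
qed

lemma smooth_not_real_eq: "\<not> is_real n \<Longrightarrow> set (smooth t n) = strands n"
  by (cases "(t, n)" rule: smooth.cases) auto

lemma strand_pairs_const:
  "set (strand_pairs D (const_state D t)) = passing_strands D \<union> label_pair D ` corners D t"
proof -
  let ?I = "{i. i < length D \<and> \<not> is_real (D ! i)}"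
  have split: "{..<length D} = ?I \<union> real_crossings D" by (auto simp: real_crossings_def)
  have "set (strand_pairs D (const_state D t))
      = (\<Union>i\<in>{..<length D}. set (smooth (const_state D t i) (D ! i)))"
    by (simp add: strand_pairs_def atLeast0LessThan)
  also have "\<dots> = (\<Union>i\<in>?I. set (smooth (const_state D t i) (D ! i)))
      \<union> (\<Union>i\<in>real_crossings D. set (smooth (const_state D t i) (D ! i)))"
    unfolding split by simp
  also have "(\<Union>i\<in>?I. set (smooth (const_state D t i) (D ! i))) = (\<Union>i\<in>?I. strands (D ! i))"
    by (simp add: smooth_not_real_eq)
  also have "\<dots> = passing_strands D"
    by (force simp: passing_strands_def in_set_conv_nth)
  also have "(\<Union>i\<in>real_crossings D. set (smooth (const_state D t i) (D ! i)))
      = (\<Union>i\<in>real_crossings D. (\<lambda>k. (label_of D (i, k), label_of D (ccw D (i, k))))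
          ` {k. k < 4 \<and> corner_colour D (i, k) = splice_colour t})"
    by (simp add: set_smooth_real const_state_def)
  also have "\<dots> = label_pair D ` corners D t"
  proof -
    have "corners D t = (\<Union>i\<in>real_crossings D. (\<lambda>k. ((i, k), ccw D (i, k)))
        ` {k. k < 4 \<and> corner_colour D (i, k) = splice_colour t})"
      by (auto simp: corners_def real_darts_eq)
    then show ?thesis by (simp add: label_pair_def image_UN image_image)
  qed
  finally show ?thesis .
qed

lemma corners_subset: "corners D t \<subseteq> real_darts D \<times> real_darts D"
  using ccw_real_darts by (auto simp: corners_def)

lemma label_real_darts: "label_of D ` real_darts D \<subseteq> labels D"
  using real_darts_subset by (intro image_subsetI label_of_in_labels) (rule subsetD)

section \<open>Curves without real crossings\<close>

lemma components_split:
  "components D = conn_classes (labels D) (passing_strands D \<union> (\<Union>n\<in>{n \<in> set D. is_real n}. strands n))"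
proof -
  have "(\<Union>n\<in>set D. strands n)
      = passing_strands D \<union> (\<Union>n\<in>{n \<in> set D. is_real n}. strands n)"
    unfolding passing_strands_def by blast
  then show ?thesis by (simp only: components_def)
qed

lemma real_strands_subset:
  "(\<Union>n\<in>{n \<in> set D. is_real n}. strands n)
    \<subseteq> (label_of D ` real_darts D) \<times> (label_of D ` real_darts D)"
proof -
  have "strands n \<subseteq> (label_of D ` real_darts D) \<times> (label_of D ` real_darts D)"
    if n: "n \<in> set D" "is_real n" for n
  proof -
    obtain i where i: "i \<in> real_crossings D" "D ! i = n"
      using n by (auto simp: real_crossings_def in_set_conv_nth)
    have "edges n \<subseteq> label_of D ` real_darts D"
    proof
      fix e assume "e \<in> edges n"
      moreover obtain k a b c d where node: "D ! i = Crossing k a b c d"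
        using i(1) by (elim real_crossing_node)
      ultimately have "e = label_of D (i, 0) \<or> e = label_of D (i, 1) \<or> e = label_of D (i, 2)
          \<or> e = label_of D (i, 3)"
        using i(2) by (auto simp: label_of_def)
      moreover have "(i, k) \<in> real_darts D" if "k < 4" for k
        using that i(1) by (simp add: real_darts_eq)
      ultimately show "e \<in> label_of D ` real_darts D" by fastforce
    qed
    then show ?thesis using strands_subset[of n] by blast
  qed
  then show ?thesis by blast
qed

text \<open>\<open>D\<close> and its constant states differ only in strands between labels at real
  crossings, and a free curve meets none of these.\<close>

lemma free_components_eq:
  "free_components D = {C \<in> conn_classes (labels D) (set (strand_pairs D (const_state D t))).
     C \<inter> label_of D ` real_darts D = {}}"
proof -
  have "label_pair D ` corners D t \<subseteq> (label_of D ` real_darts D) \<times> (label_of D ` real_darts D)"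
    using corners_subset[of D t] by (auto simp: label_pair_def)
  then show ?thesis
    unfolding free_components_def components_split strand_pairs_const
    by (simp only: conn_classes_missing[OF passing_strands_subset]
        conn_classes_missing[OF passing_strands_subset real_strands_subset])
qed

text \<open>A band condenses a walk along passing strands into one step, and a corner is a spliced
  strand.\<close>

lemma conn_dart_label_iff:
  assumes h: "h \<in> real_darts D" and h': "h' \<in> real_darts D"
  shows "(h, h') \<in> conn (band_pairs D \<union> corners D t) \<longleftrightarrow>
    (label_of D h, label_of D h') \<in> conn (set (strand_pairs D (const_state D t)))"
    (is "_ \<in> conn ?E \<longleftrightarrow> _ \<in> conn ?F")
proof
  have NF: "conn (passing_strands D) \<subseteq> conn ?F"
    by (rule conn_mono) (simp add: strand_pairs_const)
  show "(label_of D h, label_of D h') \<in> conn ?F" if "(h, h') \<in> conn ?E"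
    using that
  proof (rule conn_map)
    fix u v assume "(u, v) \<in> ?E"
    then show "(label_of D u, label_of D v) \<in> conn ?F"
    proof
      assume "(u, v) \<in> band_pairs D"
      then show ?thesis using NF by (auto simp: band_pairs_iff)
    next
      assume "(u, v) \<in> corners D t"
      then show ?thesis
        unfolding strand_pairs_const label_pair_def by (intro conn_edge) force
    qed
  qed
  have band: "(g, g') \<in> conn ?E"
    if "g \<in> real_darts D" "g' \<in> real_darts D" "(label_of D g, label_of D g') \<in> conn (passing_strands D)"
    for g g'
  proof (cases "g = g'")
    case False
    with that have "(g, g') \<in> ?E" by (simp add: band_pairs_iff)
    then show ?thesis by (rule conn_edge)
  qed simp
  \<comment> \<open>Invariant for lifting a walk on labels: the label reached lies on the arc of a
    real dart \<open>g\<close> already reached by bands and corners.\<close>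
  have "\<exists>g\<in>real_darts D. (h, g) \<in> conn ?E \<and> (label_of D g, y) \<in> conn (passing_strands D)"
    if "(label_of D h, y) \<in> conn ?F" for y
    using that
  proof (induction rule: conn_induct)
    case base
    show ?case using h by (intro bexI[of _ h]) auto
  next
    case (step y z)
    then obtain g where g: "g \<in> real_darts D" "(h, g) \<in> conn ?E"
        "(label_of D g, y) \<in> conn (passing_strands D)" by blast
    have "(y, z) \<in> conn (passing_strands D) \<or>
        (\<exists>u v. y = label_of D u \<and> z = label_of D v \<and> ((u, v) \<in> corners D t \<or> (v, u) \<in> corners D t))"
    proof (cases "(y, z) \<in> passing_strands D \<or> (z, y) \<in> passing_strands D")
      case True
      then show ?thesis by (auto intro: conn_edge conn_edge')
    next
      case False
      then have "(y, z) \<in> label_pair D ` corners D t \<or> (z, y) \<in> label_pair D ` corners D t"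
        using step.hyps(2) unfolding strand_pairs_const by blast
      then show ?thesis by (auto simp: label_pair_def)
    qed
    then show ?case
    proof
      assume "(y, z) \<in> conn (passing_strands D)"
      then show ?thesis using g(1,2) conn_trans[OF g(3)] by blast
    next
      assume "\<exists>u v. y = label_of D u \<and> z = label_of D v \<and> ((u, v) \<in> corners D t \<or> (v, u) \<in> corners D t)"
      then obtain u v where uv: "y = label_of D u" "z = label_of D v"
          "(u, v) \<in> corners D t \<or> (v, u) \<in> corners D t" by blast
      then have "u \<in> real_darts D" "v \<in> real_darts D" using corners_subset by auto
      then have "(g, u) \<in> conn ?E" using band g uv(1) by blast
      moreover have "(u, v) \<in> conn ?E" using uv(3) by (auto intro: conn_edge conn_edge')
      ultimately have "(h, v) \<in> conn ?E" using g(2) conn_trans by meson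
      then show ?thesis using \<open>v \<in> real_darts D\<close> uv(2) by auto
    qed
  qed
  moreover assume "(label_of D h, label_of D h') \<in> conn ?F"
  ultimately obtain g where g: "g \<in> real_darts D" "(h, g) \<in> conn ?E"
    "(label_of D g, label_of D h') \<in> conn (passing_strands D)" by blast
  show "(h, h') \<in> conn ?E"
    using conn_trans[OF g(2) band[OF g(1) h' g(3)]] .
qed

lemma ncomp_const_state:
  "ncomp (strand_pairs D (const_state D t))
    = card (conn_classes (real_darts D) (band_pairs D \<union> corners D t)) + card (free_components D)"
proof -
  let ?C = "conn_classes (labels D) (set (strand_pairs D (const_state D t)))"
  let ?X = "label_of D ` real_darts D"
  have "ncomp (strand_pairs D (const_state D t)) = card ?C"
    unfolding ncomp_def verts_strand_pairs by (rule refl)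
  also have "\<dots> = card ({C \<in> ?C. C \<inter> ?X \<noteq> {}} \<union> {C \<in> ?C. C \<inter> ?X = {}})"
    by (rule arg_cong[of _ _ card]) blast
  also have "\<dots> = card {C \<in> ?C. C \<inter> ?X \<noteq> {}} + card {C \<in> ?C. C \<inter> ?X = {}}"
  proof (rule card_Un_disjoint)
    have "finite ?C" by (intro finite_conn_classes finite_labels)
    then show "finite {C \<in> ?C. C \<inter> ?X \<noteq> {}}" "finite {C \<in> ?C. C \<inter> ?X = {}}" by simp_all
  qed blast
  also have "card {C \<in> ?C. C \<inter> ?X \<noteq> {}}
      = card (conn_classes (real_darts D) (band_pairs D \<union> corners D t))"
    using label_real_darts conn_dart_label_iff by (intro card_conn_classes_meeting[symmetric])
  finally show ?thesis by (simp only: free_components_eq[of D t])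
qed

section \<open>Colours along the boundary\<close>

lemma side_colour_Right:
  assumes "h \<in> real_darts D"
  shows "side_colour D (h, RightSide) \<noteq> side_colour D (h, LeftSide)"
    and "side_colour D (ccw D h, RightSide) = side_colour D (h, LeftSide)"
proof -
  obtain i k where h: "h = (i, k)" "i \<in> real_crossings D" "k < 4"
    using assms by (cases h) (auto simp: real_darts_eq)
  obtain l a b c d where node: "D ! i = Crossing l a b c d" "l \<noteq> Virtual"
    using h(2) by (elim real_crossing_node)
  have k: "k = 0 \<or> k = 1 \<or> k = 2 \<or> k = 3" using h(3) by auto
  show "side_colour D (h, RightSide) \<noteq> side_colour D (h, LeftSide)"
    using k node by (cases l) (auto simp: h corner_colour.simps)
  show "side_colour D (ccw D h, RightSide) = side_colour D (h, LeftSide)"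
    using k by (auto simp: h ccw_real)
qed

lemma colour_eq_iff: "c \<noteq> c' \<Longrightarrow> (x = c) \<longleftrightarrow> (x \<noteq> c')" for x c c' :: colour
  by (cases x; cases c; cases c') auto

lemma band_pairs_sym: "(h, h') \<in> band_pairs D \<Longrightarrow> (h', h) \<in> band_pairs D"
  using conn_sym[of "label_of D h" "label_of D h'"] by (auto simp: band_pairs_iff)

text \<open>The two sides of a half-band have different colours, so the twist rule, though it
  compares one pair of sides, makes every band join sides of equal colour.\<close>

lemma boundary_segments_turaev:
  "boundary_segments (turaev_band_surface D) =
     {((h, LeftSide), (ccw D h, RightSide)) | h. h \<in> real_darts D} \<union>
     {((h, x), (h', y)) | h h' x y. (h, h') \<in> band_pairs D \<and> side_colour D (h, x) = side_colour D (h', y)}"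
proof -
  let ?S = "turaev_band_surface D"
  \<comment> \<open>Bands are unordered, so a property of ordered pairs can be read off only if it
    is symmetric.\<close>
  have pair: "{h, h'} \<in> {{g, g'} | g g'. (g, g') \<in> band_pairs D \<and> Q g g'} \<longleftrightarrow>
      (h, h') \<in> band_pairs D \<and> Q h h'"
    if "\<And>g g'. (g, g') \<in> band_pairs D \<Longrightarrow> Q g g' \<Longrightarrow> Q g' g" for Q h h'
  proof
    assume "{h, h'} \<in> {{g, g'} | g g'. (g, g') \<in> band_pairs D \<and> Q g g'}"
    then obtain g g' where "{h, h'} = {g, g'}" "(g, g') \<in> band_pairs D" "Q g g'" by blast
    then show "(h, h') \<in> band_pairs D \<and> Q h h'"
      using that[of g g'] band_pairs_sym[of g g'] by (auto simp: doubleton_eq_iff)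
  qed blast
  have bands: "{h, h'} \<in> bands ?S \<longleftrightarrow> (h, h') \<in> band_pairs D" for h h'
    using pair[of "\<lambda>_ _. True" h h'] by (simp add: turaev_band_surface_def)
  have twisted: "{h, h'} \<in> twisted ?S
      \<longleftrightarrow> side_colour D (h, LeftSide) \<noteq> side_colour D (h', RightSide)"
    if b: "(h, h') \<in> band_pairs D" for h h'
  proof -
    have "side_colour D (g', LeftSide) \<noteq> side_colour D (g, RightSide)"
      if "(g, g') \<in> band_pairs D" "side_colour D (g, LeftSide) \<noteq> side_colour D (g', RightSide)" for g g'
      using that side_colour_Right(1)[of g D] side_colour_Right(1)[of g' D]
        colour_eq_iff[of "side_colour D (g, LeftSide)" "side_colour D (g', RightSide)"]
      unfolding band_pairs_iff by metis
    then show ?thesis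
      using b pair[of "\<lambda>h h'. side_colour D (h, LeftSide) \<noteq> side_colour D (h', RightSide)" h h']
      by (simp add: turaev_band_surface_def)
  qed
  have same: "(x = y \<longleftrightarrow> {h, h'} \<in> twisted ?S) \<longleftrightarrow> side_colour D (h, x) = side_colour D (h', y)"
    if b: "(h, h') \<in> band_pairs D" for h h' x y
  proof -
    have "side_colour D (h, RightSide) \<noteq> side_colour D (h, LeftSide)"
      "side_colour D (h', RightSide) \<noteq> side_colour D (h', LeftSide)"
      using b side_colour_Right(1) by (auto simp: band_pairs_iff)
    then show ?thesis
      unfolding twisted[OF b] using colour_eq_iff by (cases x; cases y) (simp; metis)+
  qed
  have "{((h, x), (h', y)) | h h' x y. {h, h'} \<in> bands ?S \<and> h \<noteq> h' \<and> (x = y \<longleftrightarrow> {h, h'} \<in> twisted ?S)}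
      = {((h, x), (h', y)) | h h' x y. (h, h') \<in> band_pairs D \<and> side_colour D (h, x) = side_colour D (h', y)}"
  proof -
    have "{h, h'} \<in> bands ?S \<and> h \<noteq> h' \<and> (x = y \<longleftrightarrow> {h, h'} \<in> twisted ?S)
        \<longleftrightarrow> (h, h') \<in> band_pairs D \<and> side_colour D (h, x) = side_colour D (h', y)" for h h' x y
      unfolding bands using same[of h h' x y] band_pairs_iff[of h h' D] by blast
    then show ?thesis by (simp only:)
  qed
  moreover have "half_bands ?S = real_darts D" "next_half ?S = ccw D"
    by (simp_all add: turaev_band_surface_def)
  ultimately show ?thesis unfolding boundary_segments_def by simp
qed

text \<open>Each half-band has exactly one side of the given colour. \<open>f\<close> selects it;
  forgetting the side leads back.\<close>

lemma card_boundary_colour: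
  fixes t D
  defines "V \<equiv> {v \<in> real_darts D \<times> UNIV. side_colour D v = splice_colour t}"
  shows "card {C \<in> boundary_components (turaev_band_surface D). C \<inter> V \<noteq> {}}
    = card (conn_classes (real_darts D) (band_pairs D \<union> corners D t))"
proof -
  let ?E = "band_pairs D \<union> corners D t" and ?F = "boundary_segments (turaev_band_surface D)"
  let ?c = "splice_colour t"
  define f where "f h = (h, if side_colour D (h, LeftSide) = ?c then LeftSide else RightSide)" for h
  have f_colour: "side_colour D (f h) = ?c" if "h \<in> real_darts D" for h
    using side_colour_Right(1)[OF that] colour_eq_iff by (auto simp: f_def)
  have f_eq: "f h = (h, x)" if "h \<in> real_darts D" "side_colour D (h, x) = ?c" for h x
    using side_colour_Right(1)[OF that(1)] that(2) by (cases x) (auto simp: f_def)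
  have V: "f ` real_darts D = V"
  proof (intro equalityI subsetI)
    fix v assume "v \<in> V"
    then obtain h x where "v = (h, x)" "h \<in> real_darts D" "side_colour D (h, x) = ?c"
      by (auto simp: V_def)
    then have "v = f h" by (simp add: f_eq)
    with \<open>h \<in> real_darts D\<close> show "v \<in> f ` real_darts D" by blast
  qed (auto simp: V_def f_colour, simp add: f_def)
  have "card (conn_classes (real_darts D) ?E)
      = card {C \<in> conn_classes (real_darts D \<times> UNIV) ?F. C \<inter> f ` real_darts D \<noteq> {}}"
  proof (rule card_conn_classes_meeting)
    show "f ` real_darts D \<subseteq> real_darts D \<times> UNIV" by (auto simp: f_def)
    fix h h' assume h: "h \<in> real_darts D" "h' \<in> real_darts D"
    show "(h, h') \<in> conn ?E \<longleftrightarrow> (f h, f h') \<in> conn ?F"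
    proof
      show "(f h, f h') \<in> conn ?F" if "(h, h') \<in> conn ?E"
        using that
      proof (rule conn_map)
        fix u v assume "(u, v) \<in> ?E"
        then show "(f u, f v) \<in> conn ?F"
        proof
          assume "(u, v) \<in> band_pairs D"
          moreover from this have "side_colour D (f u) = side_colour D (f v)"
            using f_colour by (simp add: band_pairs_iff)
          ultimately have "(f u, f v) \<in> ?F"
            unfolding boundary_segments_turaev f_def by blast
          then show ?thesis by (rule conn_edge)
        next
          assume "(u, v) \<in> corners D t"
          then have u: "u \<in> real_darts D" "v = ccw D u" "side_colour D (u, LeftSide) = ?c"
            by (auto simp: corners_def)
          then have "f u = (u, LeftSide)" "f v = (v, RightSide)"
            using side_colour_Right(2)[OF u(1)] ccw_real_darts[OF u(1)] by (auto intro!: f_eq)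
          moreover have "((u, LeftSide), (ccw D u, RightSide)) \<in> ?F"
            unfolding boundary_segments_turaev using u(1) by blast
          ultimately have "(f u, f v) \<in> ?F" using u(2) by simp
          then show ?thesis by (rule conn_edge)
        qed
      qed
      \<comment> \<open>Boundary segments keep the colour, and those of colour \<open>?c\<close>
        project to bands or to corners of that colour.\<close>
      have edge: "(side_colour D u = ?c \<longleftrightarrow> side_colour D v = ?c) \<and>
          (side_colour D u = ?c \<longrightarrow> (fst u, fst v) \<in> conn ?E)" if uv: "(u, v) \<in> ?F" for u v
      proof -
        from uv consider g where "g \<in> real_darts D" "u = (g, LeftSide)" "v = (ccw D g, RightSide)"
          | "(fst u, fst v) \<in> band_pairs D" "side_colour D u = side_colour D v"
          unfolding boundary_segments_turaev by auto
        then show ?thesis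
        proof cases
          case 1
          have "(g, ccw D g) \<in> corners D t" if "side_colour D u = ?c"
            unfolding corners_def using 1 that by (intro CollectI exI[of _ g]) simp
          then show ?thesis
            using 1 side_colour_Right(2)[OF 1(1)] by (auto intro: conn_edge)
        next
          case 2
          then show ?thesis by (auto intro: conn_edge)
        qed
      qed
      assume "(f h, f h') \<in> conn ?F"
      then have "side_colour D (f h') = ?c \<and> (h, fst (f h')) \<in> conn ?E"
      proof (induction rule: conn_induct)
        case base
        show ?case using f_colour h by (simp add: f_def)
      next
        case (step y z)
        then show ?case using edge[of y z] edge[of z y] conn_trans conn_sym by meson
      qed
      then show "(h, h') \<in> conn ?E" by (simp add: f_def)
    qed
  qed
  then show ?thesis
    unfolding V boundary_components_def by (simp add: turaev_band_surface_def)
qed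

lemma card_boundary_components:
  "card (boundary_components (turaev_band_surface D))
    = card (conn_classes (real_darts D) (band_pairs D \<union> corners D ASplice))
      + card (conn_classes (real_darts D) (band_pairs D \<union> corners D BSplice))"
proof -
  let ?C = "boundary_components (turaev_band_surface D)"
  let ?F = "boundary_segments (turaev_band_surface D)"
  let ?V = "\<lambda>t. {v \<in> real_darts D \<times> UNIV. side_colour D v = splice_colour t}"
  have C: "?C = conn_classes (real_darts D \<times> UNIV) ?F"
    unfolding boundary_components_def by (simp add: turaev_band_surface_def)
  have finite: "finite (real_darts D \<times> (UNIV :: side set))"
  proof -
    have "(UNIV :: side set) = {LeftSide, RightSide}" using side.exhaust by blast
    then have "finite (UNIV :: side set)" by (metis finite.emptyI finite.insertI)
    then show ?thesis by simp
  qed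
  have colour: "side_colour D v = side_colour D u" if "(u, v) \<in> conn ?F" for u v
    using that
  proof (induction rule: conn_induct)
    case (step y z)
    then have "side_colour D y = side_colour D z"
      unfolding boundary_segments_turaev using side_colour_Right(2) by auto
    with step.IH show ?case by simp
  qed simp
  have mono: "side_colour D v = side_colour D u" if "B \<in> ?C" "u \<in> B" "v \<in> B" for B u v
    using that conn_classes_mem_iff[of B _ ?F u v] colour unfolding C by blast
  have "?C = {B \<in> ?C. B \<inter> ?V ASplice \<noteq> {}} \<union> {B \<in> ?C. B \<inter> ?V BSplice \<noteq> {}}"
  proof -
    have "B \<inter> ?V ASplice \<noteq> {} \<or> B \<inter> ?V BSplice \<noteq> {}" if "B \<in> ?C" for B
    proof -
      obtain v where v: "v \<in> real_darts D \<times> UNIV" "B = conn_class (real_darts D \<times> UNIV) ?F v"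
        using \<open>B \<in> ?C\<close> unfolding C conn_classes_eq by (rule imageE)
      then have "v \<in> B" by (simp add: conn_class_def)
      with v(1) show ?thesis by (cases "side_colour D v") auto
    qed
    then show ?thesis by blast
  qed
  also have "card \<dots> = card {B \<in> ?C. B \<inter> ?V ASplice \<noteq> {}} + card {B \<in> ?C. B \<inter> ?V BSplice \<noteq> {}}"
  proof (rule card_Un_disjoint)
    show "{B \<in> ?C. B \<inter> ?V ASplice \<noteq> {}} \<inter> {B \<in> ?C. B \<inter> ?V BSplice \<noteq> {}} = {}"
    proof (intro equals0I, elim IntE CollectE conjE)
      fix B assume "B \<in> ?C" "B \<inter> ?V ASplice \<noteq> {}" "B \<inter> ?V BSplice \<noteq> {}"
      then obtain u v where "u \<in> B" "v \<in> B" "side_colour D u = Red" "side_colour D v = Blue"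
        by auto
      with mono[OF \<open>B \<in> ?C\<close>, of u v] show False by simp
    qed
  qed (simp_all add: C finite_conn_classes[OF finite])
  finally show ?thesis by (simp only: card_boundary_colour)
qed

text \<open>A free component is a curve of both constant states but bounds neither colour; the 2 of
  its sphere makes up for both losses. Disks and bands give c(D) - 2 c(D).\<close>

lemma turaev_euler_char_eq:
  assumes "virtual_link_diagram D"
  shows "turaev_euler_char D = int (ncomp (strand_pairs D (const_state D ASplice)))
    + int (ncomp (strand_pairs D (const_state D BSplice))) - int (crossing_number D)"
  unfolding turaev_euler_char_def closed_euler_char_def card_disks card_bands[OF assms]
    card_boundary_components ncomp_const_state
  by simp

theorem theorem4p2:
  fixes L :: "diagram set" and D :: diagram
  assumes "L \<in> virtual_links"
    and "D \<in> L"
    and "pseudo_adequate D"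
  shows "link_span L = 4 * int (crossing_number D) + 2 * (turaev_euler_char D - 2)"
proof -
  have D: "virtual_link_diagram D"
    using assms(1,2) unfolding virtual_links_def quotient_def by auto
  then have "D \<noteq> []" by (simp add: virtual_link_diagram_def)
  \<comment> \<open>The two curve counts add up to chi(D) + c(D), so the span is 2 c(D) + 2 (chi(D)
    + c(D)) - 4.\<close>
  then show ?thesis
    using link_span_eq[OF assms(1,2)] span_bracket_pseudo_adequate[OF assms(3)]
      turaev_euler_char_eq[OF D] by simp
qed

end
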